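(* For all positive integers $n,m$ and every integer $1\le k<m$, the bounded-error quantum query complexity of $h_{k,n,m}$ satisfies $Q(h_{k,n,m})=\tilde O\!\left(\sqrt{nm/k}+\sqrt{kn}+k+\sqrt m\right)$.
   Context: Let $n,m$ be positive integers, $1\le k<m$ an integer, $M=[n]\times[m]$ (a grid of cells with $n$ rows and $m$ columns), $\tilde M=M\cup\{\bot\}$ (pointers to cells, $\bot$ the null pointer). Let $T$ be the following fixed binary tree with $m$ leaves and $m-1$ internal nodes: if $m=2^r$, $T$ is the complete binary tree with $2^r$ leaves; if $2^r<m<2^{r+1}$, take the complete binary tree with $2^r$ leaves and add a pair of children to each of its $m-2^r$ leftmost leaves. Outgoing arcs are labeled 'left'/'right', leaves labeled $1,\dots,m$ from left to right, and $T(j)$ is the sequence of labels on the root-to-leaf-$j$ path. The alphabet is $\Sigma=\{0,1\}\times\tilde M\times\tilde M\times\tilde M$ with components $\mathrm{val},\mathrm{lpoint},\mathrm{rpoint},\mathrm{ipoint}$. The function $h_{k,n,m}\colon\Sigma^M\to\{0,1\}$ has $h_{k,n,m}(x)=1$ iff: (1) there are exactly $k$ columns $b_1,\dots,b_k$ with $\mathrm{val}(x_{i,b_s})=1$ for all $i\in[n]$, $s\in[k]$ (marked columns); (2) each marked column $b_s$ contains a unique cell $a_s$ with $x_{a_s}\ne(1,\bot,\bot,\bot)$ (special elements); (3) $\mathrm{ipoint}(x_{a_s})=a_{s+1}$ for $s\in[k-1]$, $\mathrm{ipoint}(x_{a_k})=a_1$, and $\mathrm{lpoint}(x_{a_s})=\mathrm{lpoint}(x_{a_t})$,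 $\mathrm{rpoint}(x_{a_s})=\mathrm{rpoint}(x_{a_t})$ for all $s,t\in[k]$; (4) for each non-marked column $j$, the path starting at a special element and following $\mathrm{lpoint},\mathrm{rpoint}$ as specified by $T(j)$ exists (no $\bot$ on it) and ends at a cell $\ell_j$ in column $j$ with $\mathrm{val}(x_{\ell_j})=0$. $Q(f)$ is the minimum number of queries of a quantum query algorithm (queries $O_x|c,p\rangle|w\rangle=|c,p+x_c\bmod|\Sigma|\rangle|w\rangle$, $\Sigma$ identified with $[|\Sigma|]$) outputting $f(x)$ with probability at least $9/10$ on every input. $\tilde O$ hides factors polylogarithmic in $n,m$. *)

theory Defs
  imports Complex_Main "HOL-Library.Discrete_Functions"
begin

text \<open>Cells are pairs (row, column) with rows in {1..n} and columns in {1..m}.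
  Pointers are cells or None (the null pointer).  A symbol is
  (val, lpoint, rpoint, ipoint); val is a bool (True = 1, False = 0).\<close>

type_synonym cell = "nat \<times> nat"
type_synonym ptr = "cell option"
type_synonym sym = "bool \<times> ptr \<times> ptr \<times> ptr"
type_synonym input = "cell \<Rightarrow> sym"

definition grid :: "nat \<Rightarrow> nat \<Rightarrow> cell set" where
  "grid n m = {1..n} \<times> {1..m}"

definition valid_ptr :: "nat \<Rightarrow> nat \<Rightarrow> ptr \<Rightarrow> bool" where
  "valid_ptr n m p = (case p of None \<Rightarrow> True | Some c \<Rightarrow> c \<in> grid n m)"

definition Sigma :: "nat \<Rightarrow> nat \<Rightarrow> sym set" where
  "Sigma n m = {(v, l, r, i). valid_ptr n m l \<and> valid_ptr n m r \<and> valid_ptr n m i}"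

text \<open>Inputs x in Sigma^M (values outside M are irrelevant).\<close>
definition inputs :: "nat \<Rightarrow> nat \<Rightarrow> input set" where
  "inputs n m = {x. \<forall>c\<in>grid n m. x c \<in> Sigma n m}"

definition val :: "sym \<Rightarrow> bool" where "val s = fst s"
definition lpoint :: "sym \<Rightarrow> ptr" where "lpoint s = fst (snd s)"
definition rpoint :: "sym \<Rightarrow> ptr" where "rpoint s = fst (snd (snd s))"
definition ipoint :: "sym \<Rightarrow> ptr" where "ipoint s = snd (snd (snd s))"

datatype btree = Leaf | Node btree btree

fun complete_tree :: "nat \<Rightarrow> btree" where
  "complete_tree 0 = Leaf"
| "complete_tree (Suc d) = Node (complete_tree d) (complete_tree d)"

fun grow :: "btree \<Rightarrow> nat \<Rightarrow> btree \<times> nat" where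
  "grow Leaf e = (if 0 < e then (Node Leaf Leaf, e - 1) else (Leaf, e))"
| "grow (Node l r) e =
     (let (l', e1) = grow l e; (r', e2) = grow r e1 in (Node l' r', e2))"

definition tree_T :: "nat \<Rightarrow> btree" where
  "tree_T m = (let r = floor_log m in fst (grow (complete_tree r) (m - 2 ^ r)))"

fun leaf_paths :: "btree \<Rightarrow> bool list list" where
  "leaf_paths Leaf = [[]]"
| "leaf_paths (Node l r) = map (Cons False) (leaf_paths l) @ map (Cons True) (leaf_paths r)"

definition Tpath :: "nat \<Rightarrow> nat \<Rightarrow> bool list" where
  "Tpath m j = leaf_paths (tree_T m) ! (j - 1)"

fun follow :: "input \<Rightarrow> cell \<Rightarrow> bool list \<Rightarrow> cell option" where
  "follow x c [] = Some c"
| "follow x c (d # ds) =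
     (case (if d then rpoint (x c) else lpoint (x c)) of
        None \<Rightarrow> None
      | Some c' \<Rightarrow> follow x c' ds)"

definition marked :: "nat \<Rightarrow> input \<Rightarrow> nat \<Rightarrow> bool" where
  "marked n x j = (\<forall>i\<in>{1..n}. val (x (i, j)))"

definition marked_cols :: "nat \<Rightarrow> nat \<Rightarrow> input \<Rightarrow> nat set" where
  "marked_cols n m x = {j\<in>{1..m}. marked n x j}"

text \<open>h_{k,n,m}(x) = 1.  The marked columns are enumerated as b 1, ..., b k
  (condition (1)), a s is the special element of column b s (condition (2)),
  and conditions (3), (4) follow.\<close>
definition h :: "nat \<Rightarrow> nat \<Rightarrow> nat \<Rightarrow> input \<Rightarrow> bool" where
  "h k n m x = (\<exists>b a.
     bij_betw b {1..k} (marked_cols n m x) \<and>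
     (\<forall>s\<in>{1..k}. a s \<in> grid n m \<and> snd (a s) = b s \<and>
        (\<forall>i\<in>{1..n}. (x (i, b s) \<noteq> (True, None, None, None)) \<longleftrightarrow> (i, b s) = a s)) \<and>
     (\<forall>s\<in>{1..<k}. ipoint (x (a s)) = Some (a (Suc s))) \<and>
     ipoint (x (a k)) = Some (a 1) \<and>
     (\<forall>s\<in>{1..k}. \<forall>t\<in>{1..k}. lpoint (x (a s)) = lpoint (x (a t)) \<and>
                              rpoint (x (a s)) = rpoint (x (a t))) \<and>
     (\<forall>j\<in>{1..m} - marked_cols n m x. \<forall>s\<in>{1..k}.
        \<exists>l. follow x (a s) (Tpath m j) = Some l \<and> snd l = j \<and> \<not> val (x l)))"

text \<open>Identification of Sigma with [|Sigma|] = {0..<2*(nm+1)^3}.\<close>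
definition ptr_code :: "nat \<Rightarrow> ptr \<Rightarrow> nat" where
  "ptr_code m p = (case p of None \<Rightarrow> 0 | Some (i, j) \<Rightarrow> (i - 1) * m + j)"

definition sigma_size :: "nat \<Rightarrow> nat \<Rightarrow> nat" where
  "sigma_size n m = 2 * (n * m + 1) ^ 3"

definition sym_code :: "nat \<Rightarrow> nat \<Rightarrow> sym \<Rightarrow> nat" where
  "sym_code n m s = (case s of (v, l, r, i) \<Rightarrow>
     of_bool v + 2 * (ptr_code m l + (n * m + 1) * (ptr_code m r + (n * m + 1) * ptr_code m i)))"

text \<open>Computational basis states |c, p, w> with c in M, p in [|Sigma|],
  w in a workspace {0..<W}.\<close>
type_synonym basis = "cell \<times> nat \<times> nat"
type_synonym qstate = "basis \<Rightarrow> complex"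
type_synonym qop = "basis \<Rightarrow> basis \<Rightarrow> complex"

definition qbasis :: "nat \<Rightarrow> nat \<Rightarrow> nat \<Rightarrow> basis set" where
  "qbasis n m W = grid n m \<times> {..<sigma_size n m} \<times> {..<W}"

definition apply_op :: "basis set \<Rightarrow> qop \<Rightarrow> qstate \<Rightarrow> qstate" where
  "apply_op B U \<psi> = (\<lambda>b. \<Sum>b'\<in>B. U b b' * \<psi> b')"

definition unitary_on :: "basis set \<Rightarrow> qop \<Rightarrow> bool" where
  "unitary_on B U = (\<forall>b1\<in>B. \<forall>b2\<in>B.
     (\<Sum>b\<in>B. cnj (U b b1) * U b b2) = (if b1 = b2 then 1 else 0))"

definition query_op :: "nat \<Rightarrow> nat \<Rightarrow> input \<Rightarrow> qop" where
  "query_op n m x = (\<lambda>b b'. case b' of (c, p, w) \<Rightarrow>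
     if b = (c, (p + sym_code n m (x c)) mod sigma_size n m, w) then 1 else 0)"

definition init_state :: qstate where
  "init_state = (\<lambda>b. if b = ((1, 1), 0, 0) then 1 else 0)"

fun run :: "nat \<Rightarrow> nat \<Rightarrow> nat \<Rightarrow> (nat \<Rightarrow> qop) \<Rightarrow> input \<Rightarrow> nat \<Rightarrow> qstate" where
  "run n m W U x 0 = apply_op (qbasis n m W) (U 0) init_state"
| "run n m W U x (Suc t) =
     apply_op (qbasis n m W) (U (Suc t)) (apply_op (qbasis n m W) (query_op n m x) (run n m W U x t))"

definition prob_output :: "nat \<Rightarrow> nat \<Rightarrow> nat \<Rightarrow> (nat \<Rightarrow> qop) \<Rightarrow> basis set \<Rightarrow> nat
    \<Rightarrow> input \<Rightarrow> bool \<Rightarrow> real" where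
  "prob_output n m W U Acc T x out =
     (\<Sum>b\<in>{b\<in>qbasis n m W. (b \<in> Acc) = out}. (cmod (run n m W U x T b))\<^sup>2)"

definition computes_with :: "nat \<Rightarrow> nat \<Rightarrow> (input \<Rightarrow> bool) \<Rightarrow> nat \<Rightarrow> bool" where
  "computes_with n m f T = (\<exists>W U Acc. 0 < W \<and>
     (\<forall>t\<le>T. unitary_on (qbasis n m W) (U t)) \<and> Acc \<subseteq> qbasis n m W \<and>
     (\<forall>x\<in>inputs n m. prob_output n m W U Acc T x (f x) \<ge> 9 / 10))"

definition Q :: "nat \<Rightarrow> nat \<Rightarrow> (input \<Rightarrow> bool) \<Rightarrow> nat" where
  "Q n m f = (LEAST T. computes_with n m f T)"

end

theory Submission
  imports Defs
begin

text \<open>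
  A quantum algorithm enters only through Gram matrices: if two finite families of real vectors have
  the same Gram matrix, then one orthogonal matrix (a product of reflections) maps one to the
  other.  So it suffices to write \<open>1 - G x y\<close>, where \<open>G\<close> is the Gram matrix of target states whose
  accepting part vanishes on negative inputs and whose rejecting part vanishes on positive ones, as a sum
  over cells \<open>c\<close> with \<open>x c \<noteq> y c\<close> of differences of positive semidefinite kernels (a dual adversary
  solution).  If the diagonals of these kernels sum to at most \<open>L\<close>, then \<open>40 * L\<close> queries suffice.

  Such solutions are exact and compose by addition, so no error has to be controlled along the way.
  The solution for \<open>h\<close> follows the search for a marked column (\<open>sqrt (m / k)\<close> times the cost
  \<open>sqrt n\<close> of testing a column), the search for the special cell in it (\<open>sqrt n\<close>), the cycle of \<open>k\<close>
  internal pointers, and two conjunctions: over the \<open>k * n\<close> cells of the columns on the cycle and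
  over the tree paths to the at most \<open>m\<close> other columns.  Only the correctness of the final check
  matters on negative inputs; on positive ones there are exactly \<open>k\<close> marked columns, each with one
  special cell, so that both searches can be calibrated to succeed with certainty.
\<close>

section \<open>Orthogonal matrices with prescribed images\<close>

text \<open>Nested searches with bounded error would usually pay logarithms for error reduction;
  here the only logarithm is the depth of the tree. The obstacle is that an exact search needs the
  number of good items in advance. An input with the wrong number spoils the calibration, but such
  an input is negative, and its failure amplitude (possibly of negative sign) merely joins the
  rejecting part. The budget of a kernel is a function of the input and is multiplied by the
  diagonal of any psd factor. A subroutine entered with squared amplitude \<open>q\<close> is thus
  charged only \<open>q\<close> times its cost, and squared amplitudes sum to at most 1. Hence the
  inner search and the verification add to the cost of the outer search; only the test for a good
  item is multiplied by the length of its search. Differences of psd kernels are used because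
  closure under negation allows a kernel to be restricted, without extra cost, to pairs of inputs on
  which a Boolean function differs.\<close>

definition ip :: "'b set \<Rightarrow> ('b \<Rightarrow> real) \<Rightarrow> ('b \<Rightarrow> real) \<Rightarrow> real" where
  "ip B u v = (\<Sum>b\<in>B. u b * v b)"

definition mv :: "'b set \<Rightarrow> ('b \<Rightarrow> 'b \<Rightarrow> real) \<Rightarrow> ('b \<Rightarrow> real) \<Rightarrow> 'b \<Rightarrow> real" where
  "mv B U v = (\<lambda>b. \<Sum>b'\<in>B. U b b' * v b')"

definition orth :: "'b set \<Rightarrow> ('b \<Rightarrow> 'b \<Rightarrow> real) \<Rightarrow> bool" where
  "orth B U \<longleftrightarrow> (\<forall>b1\<in>B. \<forall>b2\<in>B. (\<Sum>b\<in>B. U b b1 * U b b2) = of_bool (b1 = b2))"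

lemma ip_cong: "(\<And>b. b \<in> B \<Longrightarrow> u b = u' b) \<Longrightarrow> (\<And>b. b \<in> B \<Longrightarrow> v b = v' b) \<Longrightarrow> ip B u v = ip B u' v'"
  by (simp add: ip_def)

lemma ip_diff_left: "ip B (\<lambda>b. u b - v b) w = ip B u w - ip B v w"
  by (simp add: ip_def left_diff_distrib sum_subtractf)

lemma ip_diff_right: "ip B w (\<lambda>b. u b - v b) = ip B w u - ip B w v"
  by (simp add: ip_def right_diff_distrib sum_subtractf)

lemma ip_commute: "ip B u v = ip B v u"
  by (simp add: ip_def mult.commute)

lemma mv_cong: "(\<And>b. b \<in> B \<Longrightarrow> u b = v b) \<Longrightarrow> mv B U u = mv B U v"
  by (simp add: mv_def)

lemma mv_diff: "mv B U (\<lambda>b. u b - v b) b = mv B U u b - mv B U v b"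
  by (simp add: mv_def right_diff_distrib sum_subtractf)

lemma sum_of_bool_mult:
  fixes f :: "'b \<Rightarrow> real"
  assumes "finite B"
  shows "(\<Sum>b\<in>B. of_bool (b = a) * f b) = of_bool (a \<in> B) * f a"
    and "(\<Sum>b\<in>B. of_bool (a = b) * f b) = of_bool (a \<in> B) * f a"
proof -
  have *: "(\<Sum>b\<in>B. of_bool (b = a) * f b) = (\<Sum>b\<in>B. if b = a then f b else 0)"
    by (intro sum.cong) auto
  show "(\<Sum>b\<in>B. of_bool (b = a) * f b) = of_bool (a \<in> B) * f a"
    unfolding * using assms by (simp add: sum.delta)
  then show "(\<Sum>b\<in>B. of_bool (a = b) * f b) = of_bool (a \<in> B) * f a"
    by (simp add: eq_commute)
qed

lemma ip_mv:
  assumes "finite B" "orth B U"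
  shows "ip B (mv B U u) (mv B U v) = ip B u v"
proof -
  have "ip B (mv B U u) (mv B U v)
      = (\<Sum>b\<in>B. \<Sum>i\<in>B. \<Sum>j\<in>B. (u i * v j) * (U b i * U b j))"
    unfolding ip_def mv_def by (intro sum.cong refl) (simp add: sum_product mult_ac)
  also have "\<dots> = (\<Sum>i\<in>B. \<Sum>b\<in>B. \<Sum>j\<in>B. (u i * v j) * (U b i * U b j))"
    by (rule sum.swap)
  also have "\<dots> = (\<Sum>i\<in>B. \<Sum>j\<in>B. \<Sum>b\<in>B. (u i * v j) * (U b i * U b j))"
    by (intro sum.cong refl sum.swap)
  also have "\<dots> = (\<Sum>i\<in>B. \<Sum>j\<in>B. (u i * v j) * of_bool (i = j))"
    using assms(2) by (intro sum.cong refl) (simp add: orth_def sum_distrib_left [symmetric])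
  also have "\<dots> = (\<Sum>i\<in>B. \<Sum>j\<in>B. of_bool (i = j) * (u i * v j))"
    by (simp add: mult.commute)
  also have "\<dots> = ip B u v"
    unfolding ip_def by (intro sum.cong refl) (simp add: sum_of_bool_mult assms(1))
  finally show ?thesis .
qed

lemma mv_mult:
  assumes "finite B"
  shows "mv B (\<lambda>b b'. \<Sum>i\<in>B. V b i * U i b') v = mv B V (mv B U v)"
proof
  fix b
  have "mv B (\<lambda>b b'. \<Sum>i\<in>B. V b i * U i b') v b = (\<Sum>b'\<in>B. \<Sum>i\<in>B. V b i * (U i b' * v b'))"
    by (simp add: mv_def sum_distrib_right mult.assoc)
  also have "\<dots> = (\<Sum>i\<in>B. \<Sum>b'\<in>B. V b i * (U i b' * v b'))"
    by (rule sum.swap)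
  also have "\<dots> = mv B V (mv B U v) b"
    by (simp add: mv_def sum_distrib_left)
  finally show "mv B (\<lambda>b b'. \<Sum>i\<in>B. V b i * U i b') v b = mv B V (mv B U v) b" .
qed

lemma orth_mult:
  assumes "finite B" "orth B U" "orth B V"
  shows "orth B (\<lambda>b b'. \<Sum>i\<in>B. V b i * U i b')"
  unfolding orth_def
proof (intro ballI)
  fix b1 b2 assume b: "b1 \<in> B" "b2 \<in> B"
  have "(\<Sum>b\<in>B. (\<Sum>i\<in>B. V b i * U i b1) * (\<Sum>i\<in>B. V b i * U i b2))
      = ip B (mv B V (\<lambda>i. U i b1)) (mv B V (\<lambda>i. U i b2))"
    by (simp add: ip_def mv_def)
  also have "\<dots> = ip B (\<lambda>i. U i b1) (\<lambda>i. U i b2)"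
    by (rule ip_mv) (use assms in auto)
  also have "\<dots> = of_bool (b1 = b2)"
    using assms(2) b by (simp add: orth_def ip_def)
  finally show "(\<Sum>b\<in>B. (\<Sum>i\<in>B. V b i * U i b1) * (\<Sum>i\<in>B. V b i * U i b2)) = of_bool (b1 = b2)" .
qed

text \<open>For w = 0 the quotient is 0, and the matrix is the identity.\<close>
definition householder :: "'b set \<Rightarrow> ('b \<Rightarrow> real) \<Rightarrow> 'b \<Rightarrow> 'b \<Rightarrow> real" where
  "householder B w b b' = of_bool (b = b') - 2 / ip B w w * w b * w b'"

lemma mv_householder:
  assumes "finite B" "b \<in> B"
  shows "mv B (householder B w) v b = v b - 2 / ip B w w * ip B w v * w b"
proof -
  have "mv B (householder B w) v b
      = (\<Sum>b'\<in>B. of_bool (b = b') * v b' - (2 / ip B w w * w b) * (w b' * v b'))"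
    by (simp add: mv_def householder_def algebra_simps)
  also have "\<dots> = v b - (2 / ip B w w * w b) * ip B w v"
    using assms
    by (simp only: sum_subtractf sum_of_bool_mult sum_distrib_left [symmetric] ip_def) simp
  finally show ?thesis by simp
qed

lemma orth_householder:
  assumes "finite B"
  shows "orth B (householder B w)"
  unfolding orth_def
proof (intro ballI)
  fix b1 b2 assume b: "b1 \<in> B" "b2 \<in> B"
  define c where "c = 2 / ip B w w"
  have c: "c * (c * ip B w w) = 2 * c"
    by (simp add: c_def)
  have "(\<Sum>b\<in>B. householder B w b b1 * householder B w b b2)
      = (\<Sum>b\<in>B. of_bool (b = b1) * of_bool (b1 = b2) - of_bool (b = b1) * (c * w b * w b2)
          - of_bool (b = b2) * (c * w b * w b1) + c * c * w b1 * w b2 * (w b * w b))"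
    by (intro sum.cong refl) (auto simp: householder_def c_def [symmetric] algebra_simps)
  also have "\<dots> = of_bool (b1 = b2) - 2 * (c * w b1 * w b2) + w b1 * w b2 * (c * (c * ip B w w))"
    using b assms
    by (simp only: sum_subtractf sum.distrib sum_of_bool_mult sum_distrib_left [symmetric] ip_def)
       (simp add: algebra_simps)
  also have "\<dots> = of_bool (b1 = b2)"
    unfolding c by simp
  finally show "(\<Sum>b\<in>B. householder B w b b1 * householder B w b b2) = of_bool (b1 = b2)" .
qed

lemma orth_id: "finite B \<Longrightarrow> orth B (\<lambda>b b'. of_bool (b = b'))"
  by (auto simp: orth_def sum_of_bool_mult)

lemma ip_self_eq_0:
  assumes "finite B" "ip B w w = 0" "b \<in> B"
  shows "w b = 0"
proof -
  have "\<forall>b\<in>B. w b * w b = 0"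
    using assms(1,2) unfolding ip_def by (subst (asm) sum_nonneg_eq_0_iff) auto
  then show ?thesis using assms(3) by simp
qed

text \<open>Vectors are moved one at a time: if \<open>U\<close> already moves the earlier ones, the reflection in
  the hyperplane orthogonal to \<open>U (u z) - v z\<close> swaps these two vectors and, by equality of the
  Gram matrices, fixes all \<open>v x\<close> with \<open>x\<close> treated earlier.\<close>
lemma equal_gram_imp_orth:
  assumes "finite X" "finite B"
    and "\<And>x y. x \<in> X \<Longrightarrow> y \<in> X \<Longrightarrow> ip B (u x) (u y) = ip B (v x) (v y)"
  shows "\<exists>U. orth B U \<and> (\<forall>x\<in>X. \<forall>b\<in>B. mv B U (u x) b = v x b)"
  using assms(1,3)
proof (induction X rule: finite_induct)
  case empty
  then show ?case using orth_id [OF assms(2)] by auto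
next
  case (insert z X)
  then obtain U where U: "orth B U" "\<And>x b. x \<in> X \<Longrightarrow> b \<in> B \<Longrightarrow> mv B U (u x) b = v x b"
    by auto
  define u' where "u' = mv B U (u z)"
  define w where "w = (\<lambda>b. u' b - v z b)"
  have u'u': "ip B u' u' = ip B (v z) (v z)"
    unfolding u'_def using insert.prems by (simp add: ip_mv assms(2) U(1))
  have wx: "ip B w (v x) = 0" if "x \<in> X" for x
  proof -
    have "ip B u' (v x) = ip B (mv B U (u z)) (mv B U (u x))"
      unfolding u'_def using U(2) that by (intro ip_cong) auto
    also have "\<dots> = ip B (v z) (v x)"
      using insert.prems that by (simp add: ip_mv assms(2) U(1))
    finally show ?thesis by (simp add: w_def ip_diff_left)
  qed
  \<comment> \<open>Equal norms of \<open>u'\<close> and \<open>v z\<close> make the reflection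
    coefficient \<open>2 / ip B w w * ip B w u'\<close> equal to 1, so \<open>u'\<close> is sent
    exactly to \<open>v z\<close>.\<close>
  have ww: "ip B w w = 2 * ip B w u'"
    unfolding w_def by (simp add: ip_diff_left ip_diff_right u'u' ip_commute [of B u' "v z"])
  define U' where "U' = (\<lambda>b b'. \<Sum>i\<in>B. householder B w b i * U i b')"
  have mv: "mv B U' y b = mv B (householder B w) (mv B U y) b" for y b
    unfolding U'_def using assms(2) by (simp add: mv_mult)
  have "mv B U' (u x) b = v x b" if "x \<in> insert z X" "b \<in> B" for x b
  proof (cases "x = z")
    case True
    have "mv B U' (u x) b = u' b - 2 / ip B w w * ip B w u' * w b"
      unfolding mv True u'_def [symmetric] by (rule mv_householder) (use assms(2) that in auto)
    moreover have "2 / ip B w w * ip B w u' * w b = w b"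
    proof (cases "ip B w w = 0")
      case True
      then show ?thesis using ip_self_eq_0 [OF assms(2) True that(2)] by simp
    next
      case False
      then show ?thesis using ww by (simp add: field_simps)
    qed
    ultimately show ?thesis by (simp add: w_def True)
  next
    case False
    then have x: "x \<in> X" using that by simp
    have "mv B U' (u x) b = mv B (householder B w) (v x) b"
      unfolding mv by (rule fun_cong [OF mv_cong]) (use U(2) x in auto)
    also have "\<dots> = v x b"
      by (simp add: mv_householder assms(2) that(2) wx x)
    finally show ?thesis .
  qed
  moreover have "orth B U'"
    unfolding U'_def by (intro orth_mult orth_householder U(1) assms(2))
  ultimately show ?case by blast
qed

section \<open>Query kernels\<close>

text \<open>A finite sum of rank-one kernels is used instead of the quadratic-form condition:
  closure under products is then elementary, and the vectors of a Gram representation can be read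
  off.\<close>

definition psd :: "('x \<Rightarrow> 'x \<Rightarrow> real) \<Rightarrow> bool" where
  "psd A \<longleftrightarrow> (\<exists>fs. \<forall>x y. A x y = (\<Sum>f\<leftarrow>fs. f x * f y))"

lemma psd_rank1: "psd (\<lambda>x y. f x * f y)"
  unfolding psd_def by (rule exI [of _ "[f]"]) simp

lemma psd_0: "psd (\<lambda>x y. 0)"
  unfolding psd_def by (rule exI [of _ "[]"]) simp

lemma psd_1: "psd (\<lambda>x y. 1)"
  using psd_rank1 [of "\<lambda>_. 1"] by simp

lemma psd_add:
  assumes "psd A" "psd B"
  shows "psd (\<lambda>x y. A x y + B x y)"
proof -
  obtain fs gs where "\<And>x y. A x y = (\<Sum>f\<leftarrow>fs. f x * f y)" "\<And>x y. B x y = (\<Sum>f\<leftarrow>gs. f x * f y)"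
    using assms unfolding psd_def by blast
  then show ?thesis
    unfolding psd_def by (intro exI [of _ "fs @ gs"]) simp
qed

lemma psd_sum:
  assumes "\<And>i. i \<in> I \<Longrightarrow> psd (A i)"
  shows "psd (\<lambda>x y. \<Sum>i\<in>I. A i x y)"
  using assms by (induction I rule: infinite_finite_induct) (simp_all add: psd_0 psd_add)

lemma psd_rank1_mult:
  assumes "psd A"
  shows "psd (\<lambda>x y. f x * f y * A x y)"
proof -
  obtain gs where "\<And>x y. A x y = (\<Sum>g\<leftarrow>gs. g x * g y)"
    using assms unfolding psd_def by blast
  then show ?thesis
    unfolding psd_def
    by (intro exI [of _ "map (\<lambda>g x. f x * g x) gs"])
       (simp add: o_def sum_list_const_mult [symmetric] mult_ac)
qed

text \<open>The Schur product theorem; with rank-one sums it is mere distributivity.\<close>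

lemma psd_mult:
  assumes "psd A" "psd B"
  shows "psd (\<lambda>x y. A x y * B x y)"
proof -
  obtain fs where fs: "\<And>x y. A x y = (\<Sum>f\<leftarrow>fs. f x * f y)"
    using assms(1) unfolding psd_def by blast
  have "psd (\<lambda>x y. (\<Sum>f\<leftarrow>fs. f x * f y) * B x y)"
  proof (induction fs)
    case Nil
    then show ?case by (simp add: psd_0)
  next
    case (Cons f fs)
    then show ?case
      using psd_add [OF psd_rank1_mult [OF assms(2), of f] Cons] by (simp add: algebra_simps)
  qed
  then show ?thesis by (simp add: fs)
qed

lemma psd_diag_nonneg: "psd A \<Longrightarrow> A x x \<ge> 0"
  unfolding psd_def by (auto intro!: sum_list_nonneg)

text \<open>Padding with zero functions allows every larger dimension, so that one dimension can
  later be chosen for all kernels at once.\<close>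

lemma psd_imp_gram:
  assumes "psd A"
  shows "\<exists>N::nat. \<forall>N'\<ge>N. \<exists>f. \<forall>x y. A x y = (\<Sum>i<N'. f i x * f i y)"
proof -
  obtain fs where fs: "\<And>x y. A x y = (\<Sum>f\<leftarrow>fs. f x * f y)"
    using assms unfolding psd_def by blast
  have "\<exists>f. \<forall>x y. A x y = (\<Sum>i<N'. f i x * f i y)" if "N' \<ge> length fs" for N'
  proof (intro exI allI)
    fix x y
    let ?f = "\<lambda>i. if i < length fs then fs ! i else (\<lambda>_. 0)"
    have "(\<Sum>i<N'. ?f i x * ?f i y) = (\<Sum>i<length fs. ?f i x * ?f i y)"
      by (rule sum.mono_neutral_right) (use that in auto)
    also have "\<dots> = A x y"
      by (simp add: fs sum_list_sum_nth atLeast0LessThan)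
    finally show "A x y = (\<Sum>i<N'. ?f i x * ?f i y)" by simp
  qed
  then have "\<forall>N'\<ge>length fs. \<exists>f. \<forall>x y. A x y = (\<Sum>i<N'. f i x * f i y)"
    by blast
  then show ?thesis by (rule exI)
qed

text \<open>A search calibrated for \<open>k\<close> good items but run on an input with \<open>t\<close> of them ends with
  amplitude \<open>2 * sqrt k / (k + t)\<close> on each good item and \<open>(k - t) / (k + t)\<close> on failure;
  these are the amplitudes for which the initial and final states can be connected exactly.\<close>
definition found_amp :: "real \<Rightarrow> real \<Rightarrow> real" where
  "found_amp k t = 2 * sqrt k / (k + t)"

definition fail_amp :: "real \<Rightarrow> real \<Rightarrow> real" where
  "fail_amp k t = (k - t) / (k + t)"

text \<open>With \<open>tan (theta / 2) = sqrt (t / k)\<close> the failure amplitude is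
  \<open>cos theta\<close>, and the norm of the found part is \<open>sin theta\<close>.\<close>

lemma search_amp_norm:
  assumes "0 < k" "0 \<le> t"
  shows "t * (found_amp k t)\<^sup>2 + (fail_amp k t)\<^sup>2 = 1"
proof -
  have "k + t > 0" using assms by simp
  then show ?thesis
    using assms unfolding found_amp_def fail_amp_def
    by (simp add: power_divide power_mult_distrib add_divide_distrib [symmetric] divide_eq_1_iff)
       (simp add: power2_eq_square algebra_simps)
qed

text \<open>The factor is the mean of \<open>t\<close> and \<open>t'\<close>. Subtracting the number
  of common good items from this mean leaves half the number of items on which two inputs disagree,
  which is what queries can account for.\<close>

lemma search_amp_gram:
  assumes "0 < k" "0 \<le> t" "0 \<le> t'"
  shows "1 - fail_amp k t * fail_amp k t' = found_amp k t * found_amp k t' * (t + t') / 2"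
proof -
  have pos: "k + t > 0" "k + t' > 0" using assms by auto
  have "found_amp k t * found_amp k t' * (t + t') / 2 = 2 * k * (t + t') / ((k + t) * (k + t'))"
    using assms by (simp add: found_amp_def)
  also have "\<dots> = 1 - fail_amp k t * fail_amp k t'"
    using pos by (simp add: fail_amp_def divide_simps) (simp add: algebra_simps)
  finally show ?thesis by simp
qed

text \<open>This is what turns the cost of a subroutine run after a search into an average over the
  found items instead of a sum.\<close>

lemma found_amp_sum_le_1:
  fixes P :: "'j \<Rightarrow> bool"
  assumes "finite J" "0 < k"
  defines "t \<equiv> real (card {j \<in> J. P j})"
  shows "(\<Sum>j\<in>J. (of_bool (P j) * found_amp k t) * (of_bool (P j) * found_amp k t)) \<le> 1"
proof -
  have "(\<Sum>j\<in>J. (of_bool (P j) * found_amp k t) * (of_bool (P j) * found_amp k t))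
      = (\<Sum>j\<in>J. of_bool (P j) * (found_amp k t)\<^sup>2)"
    by (intro sum.cong) (auto simp: power2_eq_square)
  also have "\<dots> = t * (found_amp k t)\<^sup>2"
    using assms(1) by (simp add: sum_distrib_right [symmetric] t_def Int_def)
  also have "\<dots> \<le> 1"
  proof -
    have "t * (found_amp k t)\<^sup>2 + (fail_amp k t)\<^sup>2 = 1"
      using assms(2) by (rule search_amp_norm) (simp add: t_def)
    then show ?thesis using zero_le_power2 [of "fail_amp k t"] by linarith
  qed
  finally show ?thesis .
qed

section \<open>Calculus of query kernels over a finite set of inputs\<close>

locale queries =
  fixes D :: "('c \<Rightarrow> 's) set" and M :: "'c set"
  assumes finite_D: "finite D" and finite_M: "finite M"
begin

text \<open>A feasible point of the dual adversary bound for state conversion; \<open>P - R\<close>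
  is the polarized form of the usual pairing of two vector families. The budget \<open>L\<close>
  depends on the input so that branches can be charged by their weight.\<close>

definition qker :: "(('c \<Rightarrow> 's) \<Rightarrow> ('c \<Rightarrow> 's) \<Rightarrow> real) \<Rightarrow> (('c \<Rightarrow> 's) \<Rightarrow> real) \<Rightarrow> bool" where
  "qker E L \<longleftrightarrow> (\<exists>P R. (\<forall>c\<in>M. psd (P c) \<and> psd (R c)) \<and>
     (\<forall>x\<in>D. \<forall>y\<in>D. E x y = (\<Sum>c\<in>M. of_bool (x c \<noteq> y c) * (P c x y - R c x y))) \<and>
     (\<forall>x\<in>D. (\<Sum>c\<in>M. P c x x + R c x x) \<le> L x))"

lemma qker_0:
  assumes "\<And>x. x \<in> D \<Longrightarrow> 0 \<le> L x"
  shows "qker (\<lambda>x y. 0) L"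
  unfolding qker_def
  by (rule exI [of _ "\<lambda>_ _ _. 0"], rule exI [of _ "\<lambda>_ _ _. 0"]) (use assms in \<open>auto simp: psd_0\<close>)

lemma qker_cong_mono:
  assumes "qker E L" "\<And>x y. x \<in> D \<Longrightarrow> y \<in> D \<Longrightarrow> E' x y = E x y" "\<And>x. x \<in> D \<Longrightarrow> L x \<le> L' x"
  shows "qker E' L'"
proof -
  obtain P R where
    "\<forall>c\<in>M. psd (P c) \<and> psd (R c)"
    "\<And>x y. x \<in> D \<Longrightarrow> y \<in> D \<Longrightarrow> E x y = (\<Sum>c\<in>M. of_bool (x c \<noteq> y c) * (P c x y - R c x y))"
    "\<And>x. x \<in> D \<Longrightarrow> (\<Sum>c\<in>M. P c x x + R c x x) \<le> L x"
    using assms(1) unfolding qker_def by auto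
  with assms(2,3) have "(\<forall>c\<in>M. psd (P c) \<and> psd (R c)) \<and>
     (\<forall>x\<in>D. \<forall>y\<in>D. E' x y = (\<Sum>c\<in>M. of_bool (x c \<noteq> y c) * (P c x y - R c x y))) \<and>
     (\<forall>x\<in>D. (\<Sum>c\<in>M. P c x x + R c x x) \<le> L' x)"
    by (simp add: order_trans [OF _ assms(3)])
  then show ?thesis unfolding qker_def by blast
qed

lemma qker_add:
  assumes "qker E L" "qker E' L'"
  shows "qker (\<lambda>x y. E x y + E' x y) (\<lambda>x. L x + L' x)"
proof -
  obtain P R where 1:
    "\<forall>c\<in>M. psd (P c) \<and> psd (R c)"
    "\<And>x y. x \<in> D \<Longrightarrow> y \<in> D \<Longrightarrow> E x y = (\<Sum>c\<in>M. of_bool (x c \<noteq> y c) * (P c x y - R c x y))"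
    "\<And>x. x \<in> D \<Longrightarrow> (\<Sum>c\<in>M. P c x x + R c x x) \<le> L x"
    using assms(1) unfolding qker_def by auto
  obtain P' R' where 2:
    "\<forall>c\<in>M. psd (P' c) \<and> psd (R' c)"
    "\<And>x y. x \<in> D \<Longrightarrow> y \<in> D \<Longrightarrow> E' x y = (\<Sum>c\<in>M. of_bool (x c \<noteq> y c) * (P' c x y - R' c x y))"
    "\<And>x. x \<in> D \<Longrightarrow> (\<Sum>c\<in>M. P' c x x + R' c x x) \<le> L' x"
    using assms(2) unfolding qker_def by auto
  show ?thesis
    unfolding qker_def
  proof (intro exI conjI ballI)
    fix c assume "c \<in> M"
    then show "psd (\<lambda>x y. P c x y + P' c x y)" "psd (\<lambda>x y. R c x y + R' c x y)"
      using 1(1) 2(1) by (auto intro: psd_add)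
  next
    fix x y assume "x \<in> D" "y \<in> D"
    then show "E x y + E' x y =
        (\<Sum>c\<in>M. of_bool (x c \<noteq> y c) * (P c x y + P' c x y - (R c x y + R' c x y)))"
      by (simp add: 1(2) 2(2) sum.distrib [symmetric] algebra_simps)
  next
    fix x assume "x \<in> D"
    then show "(\<Sum>c\<in>M. P c x x + P' c x x + (R c x x + R' c x x)) \<le> L x + L' x"
      using 1(3) [of x] 2(3) [of x] by (simp add: sum.distrib)
  qed
qed

lemma qker_sum:
  assumes "finite J" "\<And>j. j \<in> J \<Longrightarrow> qker (E j) (L j)"
  shows "qker (\<lambda>x y. \<Sum>j\<in>J. E j x y) (\<lambda>x. \<Sum>j\<in>J. L j x)"
  using assms by (induction J rule: finite_induct) (simp_all add: qker_0 qker_add)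

lemma qker_minus:
  assumes "qker E L"
  shows "qker (\<lambda>x y. - E x y) L"
proof -
  obtain P R where 1:
    "\<forall>c\<in>M. psd (P c) \<and> psd (R c)"
    "\<And>x y. x \<in> D \<Longrightarrow> y \<in> D \<Longrightarrow> E x y = (\<Sum>c\<in>M. of_bool (x c \<noteq> y c) * (P c x y - R c x y))"
    "\<And>x. x \<in> D \<Longrightarrow> (\<Sum>c\<in>M. P c x x + R c x x) \<le> L x"
    using assms unfolding qker_def by auto
  have "- E x y = (\<Sum>c\<in>M. of_bool (x c \<noteq> y c) * (R c x y - P c x y))" if "x \<in> D" "y \<in> D" for x y
    by (simp add: 1(2) that sum_negf [symmetric] right_diff_distrib)
  with 1(1,3) have "(\<forall>c\<in>M. psd (R c) \<and> psd (P c)) \<and>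
     (\<forall>x\<in>D. \<forall>y\<in>D. - E x y = (\<Sum>c\<in>M. of_bool (x c \<noteq> y c) * (R c x y - P c x y))) \<and>
     (\<forall>x\<in>D. (\<Sum>c\<in>M. R c x x + P c x x) \<le> L x)"
    by (simp add: add.commute)
  then show ?thesis unfolding qker_def by blast
qed

text \<open>Corresponds to running a subroutine controlled by a state with Gram matrix
  \<open>A\<close>: the kernels are multiplied entrywise, and only the weight \<open>A x x\<close>
  is paid for.\<close>

lemma qker_psd_mult:
  assumes "qker E L" "psd A"
  shows "qker (\<lambda>x y. A x y * E x y) (\<lambda>x. A x x * L x)"
proof -
  obtain P R where 1:
    "\<forall>c\<in>M. psd (P c) \<and> psd (R c)"
    "\<And>x y. x \<in> D \<Longrightarrow> y \<in> D \<Longrightarrow> E x y = (\<Sum>c\<in>M. of_bool (x c \<noteq> y c) * (P c x y - R c x y))"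
    "\<And>x. x \<in> D \<Longrightarrow> (\<Sum>c\<in>M. P c x x + R c x x) \<le> L x"
    using assms(1) unfolding qker_def by auto
  show ?thesis
    unfolding qker_def
  proof (intro exI conjI ballI)
    fix c assume "c \<in> M"
    then show "psd (\<lambda>x y. A x y * P c x y)" "psd (\<lambda>x y. A x y * R c x y)"
      using 1(1) assms(2) by (auto intro: psd_mult)
  next
    fix x y assume "x \<in> D" "y \<in> D"
    then show "A x y * E x y =
        (\<Sum>c\<in>M. of_bool (x c \<noteq> y c) * (A x y * P c x y - A x y * R c x y))"
      by (simp add: 1(2) sum_distrib_left algebra_simps)
  next
    fix x assume "x \<in> D"
    have "(\<Sum>c\<in>M. A x x * P c x x + A x x * R c x x) = A x x * (\<Sum>c\<in>M. P c x x + R c x x)"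
      by (simp add: sum_distrib_left distrib_left)
    also have "\<dots> \<le> A x x * L x"
      using 1(3) \<open>x \<in> D\<close> psd_diag_nonneg [OF assms(2)] by (intro mult_left_mono) auto
    finally show "(\<Sum>c\<in>M. A x x * P c x x + A x x * R c x x) \<le> A x x * L x" .
  qed
qed

text \<open>The factor is \<open>(1 - s x * s y) / 2\<close> for the signs \<open>s = \<plusminus>1\<close> given by \<open>f\<close>; the
  subtracted part is admissible because \<open>qker\<close> is closed under negation.\<close>
lemma qker_distinguish:
  assumes "qker E L"
  shows "qker (\<lambda>x y. of_bool (f x \<noteq> (f y :: bool)) * E x y) L"
proof -
  define s :: "('c \<Rightarrow> 's) \<Rightarrow> real" where "s x = (if f x then 1 else -1)" for x
  define r where "r = sqrt (1 / 2)"
  have r: "r * r = 1 / 2" "r * (r * a) = a / 2" for a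
    by (simp_all add: r_def mult.assoc [symmetric])
  have "qker (\<lambda>x y. r * r * E x y + - ((r * s x) * (r * s y) * E x y))
          (\<lambda>x. r * r * L x + (r * s x) * (r * s x) * L x)"
    by (intro qker_add qker_minus qker_psd_mult [OF assms] psd_rank1)
  then show ?thesis
    by (rule qker_cong_mono) (simp_all add: s_def r mult_ac)
qed

text \<open>Writing down the value of \<open>G\<close> exactly means reaching orthonormal states
  indexed by that value. Their Gram matrix is \<open>of_bool (G x = G y)\<close>, and the kernel is
  1 minus it.\<close>

definition distinguishable :: "(('c \<Rightarrow> 's) \<Rightarrow> 'a) \<Rightarrow> real \<Rightarrow> bool" where
  "distinguishable G L \<longleftrightarrow> qker (\<lambda>x y. of_bool (G x \<noteq> G y)) (\<lambda>_. L)"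

lemma distinguishable_const: "0 \<le> L \<Longrightarrow> distinguishable (\<lambda>_. a) L"
  unfolding distinguishable_def by (rule qker_cong_mono [OF qker_0 [of "\<lambda>_. L"]]) auto

lemma distinguishable_mono: "distinguishable G L \<Longrightarrow> L \<le> L' \<Longrightarrow> distinguishable G L'"
  unfolding distinguishable_def by (erule qker_cong_mono) auto

lemma distinguishable_cong:
  assumes "distinguishable G L" "\<And>x y. x \<in> D \<Longrightarrow> y \<in> D \<Longrightarrow> H x = H y \<longleftrightarrow> G x = G y"
  shows "distinguishable H L"
  using assms(1) unfolding distinguishable_def by (rule qker_cong_mono) (auto simp: assms(2))

lemma distinguishable_query:
  assumes "c \<in> M"
  shows "distinguishable (\<lambda>x. x c) 1"
  unfolding distinguishable_def qker_def
proof (intro exI conjI ballI)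
  fix c' assume "c' \<in> M"
  show "psd (\<lambda>x y. of_bool (c' = c))" "psd (\<lambda>x y. 0)"
    using psd_1 psd_0 by (cases "c' = c"; simp)+
qed (use assms finite_M in \<open>simp_all add: sum_of_bool_mult\<close>)

text \<open>Intermediate results can be forgotten for free: masking the kernel of \<open>G\<close>
  by \<open>f x \<noteq> f y\<close> leaves exactly the kernel of \<open>f\<close>. The sign
  argument behind the mask requires \<open>f\<close> to have two values.\<close>

lemma distinguishable_bool:
  assumes "distinguishable G L" "\<And>x y. x \<in> D \<Longrightarrow> y \<in> D \<Longrightarrow> G x = G y \<Longrightarrow> f x = (f y :: bool)"
  shows "distinguishable f L"
  unfolding distinguishable_def
proof (rule qker_cong_mono [OF qker_distinguish [OF assms(1) [unfolded distinguishable_def], of f]])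
  fix x y assume "x \<in> D" "y \<in> D"
  then show "of_bool (f x \<noteq> f y) = of_bool (f x \<noteq> f y) * (of_bool (G x \<noteq> G y) :: real)"
    using assms(2) [of x y] by (cases "G x = G y") simp_all
qed simp

text \<open>Adaptive composition. Two inputs are separated either by \<open>G\<close> or, within a
  common branch \<open>g\<close>, by \<open>F g\<close>. Each input has weight 1 in its own branch
  and 0 in the others, so the costs add however many branches exist.\<close>

lemma distinguishable_bind:
  assumes "distinguishable G L1" "\<And>g. g \<in> G ` D \<Longrightarrow> distinguishable (F g) L2"
    and H: "\<And>x y. x \<in> D \<Longrightarrow> y \<in> D \<Longrightarrow> H x = H y \<longleftrightarrow> G x = G y \<and> F (G x) x = F (G x) y"
  shows "distinguishable H (L1 + L2)"
proof -
  have "qker (\<lambda>x y. of_bool (G x \<noteq> G y) +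
          (\<Sum>g\<in>G ` D. (of_bool (G x = g) * of_bool (G y = g)) * of_bool (F g x \<noteq> F g y)))
        (\<lambda>x. L1 + (\<Sum>g\<in>G ` D. (of_bool (G x = g) * of_bool (G x = g)) * L2))"
    using assms(1,2) finite_D unfolding distinguishable_def
    by (intro qker_add qker_sum qker_psd_mult psd_rank1) auto
  then show ?thesis
    unfolding distinguishable_def
  proof (rule qker_cong_mono)
    fix x y assume xy: "x \<in> D" "y \<in> D"
    have "(\<Sum>g\<in>G ` D. (of_bool (G x = g) * of_bool (G y = g)) * of_bool (F g x \<noteq> F g y))
        = (\<Sum>g\<in>G ` D. of_bool (G x = g) * (of_bool (G y = g) * of_bool (F g x \<noteq> F g y)) :: real)"
      by (simp add: mult.assoc)
    also have "\<dots> = of_bool (G y = G x) * of_bool (F (G x) x \<noteq> F (G x) y)"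
      using xy finite_D by (subst sum_of_bool_mult) auto
    finally show "of_bool (H x \<noteq> H y) = of_bool (G x \<noteq> G y) +
        (\<Sum>g\<in>G ` D. (of_bool (G x = g) * of_bool (G y = g)) * of_bool (F g x \<noteq> F g y) :: real)"
      using H [OF xy] by auto
  next
    fix x assume x: "x \<in> D"
    have "(\<Sum>g\<in>G ` D. (of_bool (G x = g) * of_bool (G x = g)) * L2)
        = (\<Sum>g\<in>G ` D. of_bool (G x = g) * L2)"
      by (intro sum.cong) auto
    also have "\<dots> = L2"
      using x finite_D by (subst sum_of_bool_mult) auto
    finally show "L1 + (\<Sum>g\<in>G ` D. (of_bool (G x = g) * of_bool (G x = g)) * L2) \<le> L1 + L2"
      by simp
  qed
qed

lemma distinguishable_bind_bool:
  assumes "distinguishable G L1" "\<And>g. g \<in> G ` D \<Longrightarrow> distinguishable (F g) L2"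
  shows "distinguishable (\<lambda>x. F (G x) x :: bool) (L1 + L2)"
proof -
  have "distinguishable (\<lambda>x. (G x, F (G x) x)) (L1 + L2)"
    by (rule distinguishable_bind [OF assms]) auto
  then show ?thesis by (rule distinguishable_bool) auto
qed

lemma distinguishable_conj:
  assumes "distinguishable f L1" "distinguishable g L2" "0 \<le> L2"
  shows "distinguishable (\<lambda>x. f x \<and> g x) (L1 + L2)"
proof (rule distinguishable_bind_bool [where F = "\<lambda>b x. b \<and> g x", OF assms(1)])
  show "distinguishable (\<lambda>x. b \<and> g x) L2" for b
    using assms(2,3) by (cases b) (simp_all add: distinguishable_const)
qed

text \<open>Weights of the dual adversary solution for OR: inputs without a witness spread
  their weight over all items, the others put it on a single witness.\<close>
lemma distinguishable_ex:
  assumes "finite J" "\<And>j. j \<in> J \<Longrightarrow> distinguishable (z j) C" "0 \<le> C"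
  shows "distinguishable (\<lambda>x. \<exists>j\<in>J. z j x) (sqrt (card J) * C)"
proof (cases "J = {}")
  case True
  then show ?thesis by (simp add: distinguishable_const)
next
  case False
  define s where "s = sqrt (card J)"
  have s: "s > 0" "s * s = card J"
    using False assms(1) by (simp_all add: s_def card_gt_0_iff)
  define f where "f x \<longleftrightarrow> (\<exists>j\<in>J. z j x)" for x
  define g where "g x = (SOME j. j \<in> J \<and> z j x)" for x
  have g: "g x \<in> J" "z (g x) x" if "f x" for x
    using someI_ex [of "\<lambda>j. j \<in> J \<and> z j x"] that unfolding f_def g_def by auto
  \<comment> \<open>At the chosen witness the weights of a positive and a negative input multiply to
    1, while the squared weights sum to \<open>s\<close> on either side.\<close>
  define w where "w j x = (if f x then of_bool (j = g x) * sqrt s else 1 / sqrt s)" for j x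
  \<comment> \<open>The inner sum is controlled only for pairs with different values of
    \<open>f\<close>; the mask discards all other pairs.\<close>
  have "qker (\<lambda>x y. of_bool (f x \<noteq> f y) * (\<Sum>j\<in>J. (w j x * w j y) * of_bool (z j x \<noteq> z j y)))
          (\<lambda>x. \<Sum>j\<in>J. (w j x * w j x) * C)"
    using assms(1,2) unfolding distinguishable_def
    by (intro qker_distinguish qker_sum qker_psd_mult psd_rank1) auto
  then have "distinguishable f (s * C)"
    unfolding distinguishable_def
  proof (rule qker_cong_mono)
    have *: "(\<Sum>j\<in>J. (w j x * w j y) * of_bool (z j x \<noteq> z j y)) = 1" if "f x" "\<not> f y" for x y
    proof -
      have "(\<Sum>j\<in>J. (w j x * w j y) * of_bool (z j x \<noteq> z j y))
          = (\<Sum>j\<in>J. of_bool (j = g x) * of_bool (z j x \<noteq> z j y))"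
        using that s by (intro sum.cong) (auto simp: w_def)
      also have "\<dots> = of_bool (g x \<in> J) * of_bool (z (g x) x \<noteq> z (g x) y)"
        by (rule sum_of_bool_mult(1) [OF assms(1)])
      also have "\<dots> = 1"
        using that g [OF that(1)] by (auto simp: f_def)
      finally show ?thesis .
    qed
    fix x y assume "x \<in> D" "y \<in> D"
    have "(\<Sum>j\<in>J. (w j x * w j y) * of_bool (z j x \<noteq> z j y)) = 1" if ne: "f x \<noteq> f y"
    proof (cases "f x")
      case True
      then show ?thesis using * ne by simp
    next
      case False
      have "(\<Sum>j\<in>J. (w j x * w j y) * of_bool (z j x \<noteq> z j y))
          = (\<Sum>j\<in>J. (w j y * w j x) * of_bool (z j y \<noteq> z j x))"
        by (intro sum.cong) auto
      then show ?thesis using * [of y x] False ne by simp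
    qed
    then show "of_bool (f x \<noteq> f y) =
        of_bool (f x \<noteq> f y) * (\<Sum>j\<in>J. (w j x * w j y) * of_bool (z j x \<noteq> z j y))"
      by auto
  next
    fix x assume "x \<in> D"
    show "(\<Sum>j\<in>J. (w j x * w j x) * C) \<le> s * C"
    proof (cases "f x")
      case True
      have "(\<Sum>j\<in>J. (w j x * w j x) * C) = (\<Sum>j\<in>J. of_bool (j = g x) * (s * C))"
        using True s by (intro sum.cong) (auto simp: w_def)
      also have "\<dots> = s * C"
        using g [OF True] assms(1) by (subst sum_of_bool_mult) auto
      finally show ?thesis by simp
    next
      case False
      have "(\<Sum>j\<in>J. (w j x * w j x) * C) = card J / s * C"
        using False s by (simp add: w_def)
      also have "\<dots> = s * C"
        using s by (simp add: s(2) [symmetric])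
      finally show ?thesis by simp
    qed
  qed
  then show ?thesis by (simp add: f_def [abs_def] s_def)
qed

lemma distinguishable_all:
  assumes "finite J" "\<And>j. j \<in> J \<Longrightarrow> distinguishable (z j) C" "0 \<le> C"
  shows "distinguishable (\<lambda>x. \<forall>j\<in>J. z j x) (sqrt (card J) * C)"
proof -
  have "distinguishable (\<lambda>x. \<exists>j\<in>J. \<not> z j x) (sqrt (card J) * C)"
    using assms(2) by (intro distinguishable_ex assms(1,3)) (auto intro: distinguishable_cong)
  then show ?thesis by (rule distinguishable_cong) auto
qed

text \<open>By \<open>search_amp_gram\<close> the kernel equals half the product of the two found
  amplitudes times the number of items on which the inputs disagree, because
  \<open>(a + b) / 2 - a * b\<close> is half the indicator of \<open>a \<noteq> b\<close> for
  bits.\<close>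

lemma qker_search:
  assumes "finite J" "J \<noteq> {}" "\<And>j. j \<in> J \<Longrightarrow> distinguishable (z j) C" "0 \<le> C" "0 < k"
  defines "t \<equiv> \<lambda>x. real (card {j \<in> J. z j x})"
  shows "qker (\<lambda>x y. 1 - fail_amp k (t x) * fail_amp k (t y) -
           (\<Sum>j\<in>J. (of_bool (z j x) * found_amp k (t x)) * (of_bool (z j y) * found_amp k (t y))))
         (\<lambda>_. 2 * sqrt (card J / k) * C)"
proof -
  define r where "r = sqrt (card J / k)"
  have r: "r > 0" "r * r = card J / k"
    using assms(1,2,5) by (simp_all add: r_def card_gt_0_iff)
  \<comment> \<open>Only disagreeing items matter, and there the two weights contribute the factor
    1/2. Good items cost at most \<open>r\<close> in total, since the found part has norm at most 1;
    the others cost at most \<open>card J * (4 / k) / (4 * r)\<close>, which is again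
    \<open>r\<close> because \<open>r * r = card J / k\<close>.\<close>
  define w where "w j x = found_amp k (t x) * (if z j x then sqrt r else 1 / (2 * sqrt r))" for j x
  have t: "t x \<ge> 0" for x by (simp add: t_def)
  have "qker (\<lambda>x y. \<Sum>j\<in>J. (w j x * w j y) * of_bool (z j x \<noteq> z j y))
          (\<lambda>x. \<Sum>j\<in>J. (w j x * w j x) * C)"
    using assms(1,3) unfolding distinguishable_def
    by (intro qker_sum qker_psd_mult psd_rank1) auto
  then show ?thesis
    unfolding r_def [symmetric]
  proof (rule qker_cong_mono)
    fix x y
    let ?a = "found_amp k (t x) * found_amp k (t y)"
    have tsum: "t x = (\<Sum>j\<in>J. of_bool (z j x))" for x
      using assms(1) by (simp add: t_def Int_def)
    have "(\<Sum>j\<in>J. (w j x * w j y) * of_bool (z j x \<noteq> z j y))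
        = (\<Sum>j\<in>J. ?a / 2 * (of_bool (z j x) + of_bool (z j y))
              - ?a * (of_bool (z j x) * of_bool (z j y)))"
      using r by (intro sum.cong) (auto simp: w_def)
    also have "\<dots> = ?a * (t x + t y) / 2 - (\<Sum>j\<in>J. ?a * (of_bool (z j x) * of_bool (z j y)))"
      by (simp only: sum_subtractf sum_distrib_left [symmetric] sum.distrib tsum) simp
    also have "\<dots> = 1 - fail_amp k (t x) * fail_amp k (t y) -
           (\<Sum>j\<in>J. (of_bool (z j x) * found_amp k (t x)) * (of_bool (z j y) * found_amp k (t y)))"
      using search_amp_gram [OF assms(5) t t, of x y] by (simp add: mult_ac)
    finally show "1 - fail_amp k (t x) * fail_amp k (t y) -
           (\<Sum>j\<in>J. (of_bool (z j x) * found_amp k (t x)) * (of_bool (z j y) * found_amp k (t y)))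
        = (\<Sum>j\<in>J. (w j x * w j y) * of_bool (z j x \<noteq> z j y))" ..
  next
    fix x
    let ?a = "found_amp k (t x)"
    have "t x * ?a\<^sup>2 \<le> 1"
      using search_amp_norm [OF assms(5) t, of x] zero_le_power2 [of "fail_amp k (t x)"] by linarith
    moreover have "?a\<^sup>2 \<le> 4 / k"
    proof -
      have "?a \<le> 2 * sqrt k / k"
        unfolding found_amp_def using assms(5) t [of x] by (intro divide_left_mono) auto
      moreover have "?a \<ge> 0"
        unfolding found_amp_def using assms(5) t [of x] by simp
      ultimately have "?a\<^sup>2 \<le> (2 * sqrt k / k)\<^sup>2"
        by (rule power_mono)
      also have "\<dots> = 4 / k"
        using assms(5) by (simp add: power2_eq_square field_simps)
      finally show ?thesis .
    qed
    moreover have "(\<Sum>j\<in>J. w j x * w j x) \<le> (\<Sum>j\<in>J. ?a\<^sup>2 * r * of_bool (z j x) + ?a\<^sup>2 / (4 * r))"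
      using r by (intro sum_mono) (auto simp: w_def power2_eq_square field_simps)
    moreover have "(\<Sum>j\<in>J. ?a\<^sup>2 * r * of_bool (z j x) + ?a\<^sup>2 / (4 * r))
        = (t x * ?a\<^sup>2) * r + (card J * ?a\<^sup>2) / (4 * r)"
      using assms(1) by (simp add: sum.distrib sum_distrib_left [symmetric] t_def Int_def)
    moreover have "(t x * ?a\<^sup>2) * r \<le> 1 * r"
      using calculation(1) r(1) by (intro mult_right_mono) auto
    moreover have "(card J * ?a\<^sup>2) / (4 * r) \<le> (card J * (4 / k)) / (4 * r)"
      using calculation(2) r(1) by (intro divide_right_mono mult_left_mono) auto
    ultimately have "(\<Sum>j\<in>J. w j x * w j x) \<le> r + (card J * (4 / k)) / (4 * r)"
      by linarith
    also have "\<dots> = r + r * r / r"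
      by (simp add: r(2))
    also have "\<dots> = 2 * r"
      using r(1) by simp
    finally show "(\<Sum>j\<in>J. (w j x * w j x) * C) \<le> 2 * r * C"
      using assms(4) by (simp add: sum_distrib_right [symmetric] mult_right_mono)
  qed
qed

end

section \<open>Encoding of inputs and queries\<close>

text \<open>Symbols outside the grid are arbitrary, so \<open>inputs\<close> is infinite, whereas
  the Gram argument needs a finite family; fixing these symbols provides one.\<close>

definition canon :: "nat \<Rightarrow> nat \<Rightarrow> input \<Rightarrow> input" where
  "canon n m x = (\<lambda>c. if c \<in> grid n m then x c else (False, None, None, None))"

definition canon_inputs :: "nat \<Rightarrow> nat \<Rightarrow> input set" where
  "canon_inputs n m = {x. \<forall>c. (c \<in> grid n m \<longrightarrow> x c \<in> Sigma n m) \<and>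
     (c \<notin> grid n m \<longrightarrow> x c = (False, None, None, None))}"

lemma canon_in_canon_inputs: "x \<in> inputs n m \<Longrightarrow> canon n m x \<in> canon_inputs n m"
  by (simp add: canon_def canon_inputs_def inputs_def)

lemma canon_inputs_subset: "canon_inputs n m \<subseteq> inputs n m"
  by (auto simp: canon_inputs_def inputs_def)

lemma finite_grid: "finite (grid n m)"
  by (simp add: grid_def)

lemma valid_ptr_iff: "valid_ptr n m p \<longleftrightarrow> p \<in> insert None (Some ` grid n m)"
  by (cases p) (auto simp: valid_ptr_def)

lemma finite_Sigma: "finite (Sigma n m)"
proof (rule finite_subset)
  let ?P = "insert None (Some ` grid n m)"
  show "Sigma n m \<subseteq> UNIV \<times> ?P \<times> ?P \<times> ?P"
    unfolding Sigma_def valid_ptr_iff by blast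
  show "finite (UNIV \<times> ?P \<times> ?P \<times> ?P :: sym set)"
    by (simp add: finite_grid)
qed

lemma finite_canon_inputs: "finite (canon_inputs n m)"
  unfolding canon_inputs_def by (rule finite_set_of_finite_funs [OF finite_grid finite_Sigma])

interpretation canon: queries "canon_inputs n m" "grid n m" for n m
  by unfold_locales (simp_all add: finite_canon_inputs finite_grid)

section \<open>Injectivity and range of the symbol codes\<close>

lemma ptr_code_le:
  assumes "valid_ptr n m p"
  shows "ptr_code m p \<le> n * m"
proof (cases p)
  case (Some c)
  obtain i j where c: "c = (i, j)" by fastforce
  with assms Some have ij: "1 \<le> i" "i \<le> n" "j \<le> m"
    by (auto simp: valid_ptr_def grid_def)
  have "(i - 1) * m + j \<le> (i - 1) * m + m"
    using ij by simp
  also have "\<dots> = i * m"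
    using ij by (cases i) auto
  also have "\<dots> \<le> n * m"
    using ij by simp
  finally show ?thesis by (simp add: ptr_code_def Some c)
qed (simp add: ptr_code_def)

lemma digit_inj:
  fixes a b a' b' N :: nat
  assumes "a + N * b = a' + N * b'" "a < N" "a' < N"
  shows "a = a' \<and> b = b'"
proof -
  have "(a + N * b) mod N = (a' + N * b') mod N" "(a + N * b) div N = (a' + N * b') div N"
    using assms(1) by simp_all
  then show ?thesis using assms(2,3) by auto
qed

lemma ptr_code_inj:
  assumes "valid_ptr n m p" "valid_ptr n m q" "ptr_code m p = ptr_code m q"
  shows "p = q"
proof (cases "p = None \<or> q = None")
  case True
  then show ?thesis
    using assms by (auto simp: ptr_code_def valid_ptr_def grid_def split: option.splits)
next
  case False
  then obtain i j i' j' where pq: "p = Some (i, j)" "q = Some (i', j')"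
    by (metis not_None_eq prod.exhaust)
  then have ij: "1 \<le> i" "1 \<le> i'" "1 \<le> j" "1 \<le> j'" "j \<le> m" "j' \<le> m"
    using assms(1,2) by (auto simp: valid_ptr_def grid_def)
  have "(i - 1) * m + j = (i' - 1) * m + j'"
    using assms(3) by (simp only: pq ptr_code_def option.case prod.case)
  \<comment> \<open>Columns run from 1 to \<open>m\<close>; shifted down by one they are genuine
    digits in base \<open>m\<close>. The code 0 stays free for the null pointer.\<close>
  then have "(j - 1) + m * (i - 1) = (j' - 1) + m * (i' - 1)"
    using ij(3,4) by (simp only: mult.commute [of m])
  then have "j - 1 = j' - 1 \<and> i - 1 = i' - 1"
    by (rule digit_inj) (use ij in linarith)+
  then have "j = j'" "i = i'"
    using ij by linarith+
  then show ?thesis by (simp add: pq)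
qed

lemma sym_code_inj:
  assumes "s \<in> Sigma n m" "s' \<in> Sigma n m" "sym_code n m s = sym_code n m s'"
  shows "s = s'"
proof -
  obtain v l r i where s: "s = (v, l, r, i)" by (cases s)
  obtain v' l' r' i' where s': "s' = (v', l', r', i')" by (cases s')
  have valid: "valid_ptr n m l" "valid_ptr n m r" "valid_ptr n m i"
    "valid_ptr n m l'" "valid_ptr n m r'" "valid_ptr n m i'"
    using assms by (auto simp: Sigma_def s s')
  have lt: "ptr_code m p < n * m + 1" if "valid_ptr n m p" for p
    using ptr_code_le [OF that] by simp
  note eq = assms(3) [unfolded s s' sym_code_def prod.case]
  have 1: "of_bool v = (of_bool v' :: nat) \<and>
      ptr_code m l + (n * m + 1) * (ptr_code m r + (n * m + 1) * ptr_code m i)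
      = ptr_code m l' + (n * m + 1) * (ptr_code m r' + (n * m + 1) * ptr_code m i')"
    by (rule digit_inj [OF eq]) auto
  note 2 = digit_inj [OF conjunct2 [OF 1] lt lt, OF valid(1,4)]
  note 3 = digit_inj [OF conjunct2 [OF 2] lt lt, OF valid(2,5)]
  have "v = v'"
    using conjunct1 [OF 1] by (simp only: of_bool_eq_iff)
  moreover have "l = l'" "r = r'" "i = i'"
    using 2 3 by (auto intro: ptr_code_inj valid)
  ultimately show ?thesis by (simp only: s s')
qed

lemma sym_code_less:
  assumes "s \<in> Sigma n m"
  shows "sym_code n m s < sigma_size n m"
proof -
  obtain v l r i where s: "s = (v, l, r, i)" by (cases s)
  have valid: "valid_ptr n m l" "valid_ptr n m r" "valid_ptr n m i"
    using assms by (auto simp: Sigma_def s)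
  define N where "N = n * m + 1"
  have step: "a + N * b < N * c" if "a < N" "b < c" for a b c :: nat
  proof -
    have "a + N * b < N * (b + 1)" using that by simp
    also have "\<dots> \<le> N * c" using that by (intro mult_le_mono2) simp
    finally show ?thesis .
  qed
  have lt: "ptr_code m p < N" if "valid_ptr n m p" for p
    using ptr_code_le [OF that] by (simp add: N_def)
  have "ptr_code m l + N * (ptr_code m r + N * ptr_code m i) < N * (N * N)"
    by (intro step lt valid)
  then have "of_bool v + 2 * (ptr_code m l + N * (ptr_code m r + N * ptr_code m i)) < 2 * N ^ 3"
    by (cases v) (simp_all add: power3_eq_cube)
  then show ?thesis
    by (simp add: s sym_code_def sigma_size_def N_def)
qed

lemma sum_lessThan_5_mult:
  fixes g :: "nat \<Rightarrow> real"
  shows "(\<Sum>w<5 * N. g w) = (\<Sum>i<N. g (5*i) + g (5*i+1) + g (5*i+2) + g (5*i+3) + g (5*i+4))"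
proof (induction N)
  case (Suc N)
  have "{..<5 * Suc N} = insert (5*N+4) (insert (5*N+3) (insert (5*N+2) (insert (5*N+1) (insert (5*N) {..<5*N}))))"
    by auto
  then show ?case using Suc by simp
qed simp

section \<open>Queries as real orthogonal matrices, and runs over the reals\<close>

definition query_mat :: "nat \<Rightarrow> nat \<Rightarrow> input \<Rightarrow> basis \<Rightarrow> basis \<Rightarrow> real" where
  "query_mat n m x b b' = (case b' of (c, p, w) \<Rightarrow>
     of_bool (b = (c, (p + sym_code n m (x c)) mod sigma_size n m, w)))"

lemma query_op_eq: "query_op n m x b b' = complex_of_real (query_mat n m x b b')"
  by (auto simp: query_op_def query_mat_def split: prod.splits)

lemma finite_qbasis: "finite (qbasis n m W)"
  by (simp add: qbasis_def finite_grid)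

lemma mod_shift_nat:
  fixes p k S :: nat
  assumes "p < S" "k < S"
  shows "(p + (S - k)) mod S = (if k \<le> p then p - k else p + S - k)"
    and "(p + k) mod S = (if p + k < S then p + k else p + k - S)"
  using assms by (auto simp: mod_if)

lemma mod_shift_iff:
  fixes p p' k S :: nat
  assumes "p < S" "p' < S" "k < S"
  shows "p = (p' + k) mod S \<longleftrightarrow> p' = (p + (S - k)) mod S"
  unfolding mod_shift_nat(1) [OF assms(1,3)] mod_shift_nat(2) [OF assms(2,3)]
  using assms by auto

text \<open>The amplitude at \<open>p\<close> comes from the preimage of \<open>p\<close> under the
  shift, hence the subtraction of the code, written so as to stay within the naturals.\<close>

lemma mv_query_mat:
  assumes "x \<in> inputs n m" "(c, p, w) \<in> qbasis n m W"
  shows "mv (qbasis n m W) (query_mat n m x) v (c, p, w)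
       = v (c, (p + (sigma_size n m - sym_code n m (x c))) mod sigma_size n m, w)"
proof -
  let ?S = "sigma_size n m" and ?k = "sym_code n m (x c)"
  have mem: "c \<in> grid n m" "p < ?S" "w < W"
    using assms(2) by (auto simp: qbasis_def)
  have k: "?k < ?S"
    using assms(1) mem(1) by (intro sym_code_less) (simp add: inputs_def)
  define b where "b = (c, (p + (?S - ?k)) mod ?S, w)"
  have b: "b \<in> qbasis n m W"
    using mem by (simp add: b_def qbasis_def)
  have "query_mat n m x (c, p, w) b' = of_bool (b' = b)" if "b' \<in> qbasis n m W" for b'
  proof -
    obtain c' p' w' where b': "b' = (c', p', w')" by (cases b')
    have "p = (p' + ?k) mod ?S \<longleftrightarrow> p' = (p + (?S - ?k)) mod ?S"
      using that mem(2) k by (intro mod_shift_iff) (auto simp: b' qbasis_def)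
    then show ?thesis
      by (auto simp: query_mat_def b' b_def)
  qed
  then have "mv (qbasis n m W) (query_mat n m x) v (c, p, w) = (\<Sum>b'\<in>qbasis n m W. of_bool (b' = b) * v b')"
    by (simp add: mv_def)
  also have "\<dots> = v b"
    using b by (subst sum_of_bool_mult) (auto simp: finite_qbasis)
  finally show ?thesis by (simp add: b_def)
qed

lemma orth_query_mat:
  assumes "x \<in> inputs n m"
  shows "orth (qbasis n m W) (query_mat n m x)"
  unfolding orth_def
proof (intro ballI)
  fix b1 b2 assume b: "b1 \<in> qbasis n m W" "b2 \<in> qbasis n m W"
  obtain c1 p1 w1 where b1: "b1 = (c1, p1, w1)" by (cases b1)
  obtain c2 p2 w2 where b2: "b2 = (c2, p2, w2)" by (cases b2)
  let ?S = "sigma_size n m"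
  \<comment> \<open>A query permutes the basis; orthogonality reduces to injectivity of
    \<open>\<sigma>\<close>.\<close>
  define \<sigma> where "\<sigma> = (\<lambda>(c, p, w). (c, (p + sym_code n m (x c)) mod ?S, w :: nat))"
  have k: "sym_code n m (x c) < ?S" if "c \<in> grid n m" for c
    using assms that by (intro sym_code_less) (simp add: inputs_def)
  have "(\<Sum>b\<in>qbasis n m W. query_mat n m x b b1 * query_mat n m x b b2)
      = (\<Sum>b\<in>qbasis n m W. of_bool (b = \<sigma> b1) * of_bool (b = \<sigma> b2))"
    by (simp add: query_mat_def \<sigma>_def b1 b2)
  also have "\<dots> = of_bool (\<sigma> b1 = \<sigma> b2)"
    using b by (subst sum_of_bool_mult) (auto simp: finite_grid \<sigma>_def b1 b2 qbasis_def)
  also have "\<sigma> b1 = \<sigma> b2 \<longleftrightarrow> b1 = b2"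
  proof
    assume eq: "\<sigma> b1 = \<sigma> b2"
    let ?k = "sym_code n m (x c1)"
    have c: "c1 \<in> grid n m" "c1 = c2" "w1 = w2" and p: "p1 < ?S" "p2 < ?S"
      "(p1 + ?k) mod ?S = (p2 + ?k) mod ?S"
      using b eq by (auto simp: \<sigma>_def b1 b2 qbasis_def)
    have "p = ((p + ?k) mod ?S + (?S - ?k)) mod ?S" if "p < ?S" for p
      using that k [OF c(1)] by (subst mod_shift_iff [symmetric]) auto
    then have "p1 = p2" using p by metis
    then show "b1 = b2" using c by (simp add: b1 b2)
  qed simp
  finally show "(\<Sum>b\<in>qbasis n m W. query_mat n m x b b1 * query_mat n m x b b2) = of_bool (b1 = b2)" .
qed

lemma apply_op_of_real:
  "apply_op B (\<lambda>b b'. complex_of_real (U b b')) (\<lambda>b. complex_of_real (v b))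
   = (\<lambda>b. complex_of_real (mv B U v b))"
  by (simp add: apply_op_def mv_def)

lemma unitary_on_of_real:
  assumes "orth B U"
  shows "unitary_on B (\<lambda>b b'. complex_of_real (U b b'))"
  unfolding unitary_on_def
proof (intro ballI)
  fix b1 b2 assume "b1 \<in> B" "b2 \<in> B"
  then have "complex_of_real (\<Sum>b\<in>B. U b b1 * U b b2) = of_real (of_bool (b1 = b2))"
    using assms by (simp add: orth_def)
  then show "(\<Sum>b\<in>B. cnj (complex_of_real (U b b1)) * complex_of_real (U b b2)) = (if b1 = b2 then 1 else 0)"
    by simp
qed

fun real_run :: "nat \<Rightarrow> nat \<Rightarrow> nat \<Rightarrow> (nat \<Rightarrow> basis \<Rightarrow> basis \<Rightarrow> real) \<Rightarrow> input \<Rightarrow> nat \<Rightarrow> basis \<Rightarrow> real" where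
  "real_run n m W V x 0 = mv (qbasis n m W) (V 0) (\<lambda>b. of_bool (b = ((1, 1), 0, 0)))"
| "real_run n m W V x (Suc t) =
     mv (qbasis n m W) (V (Suc t)) (mv (qbasis n m W) (query_mat n m x) (real_run n m W V x t))"

lemma run_of_real:
  "run n m W (\<lambda>t b b'. complex_of_real (V t b b')) x t = (\<lambda>b. complex_of_real (real_run n m W V x t b))"
proof (induction t)
  case 0
  have init: "init_state = (\<lambda>b. complex_of_real (of_bool (b = ((1, 1), 0, 0))))"
    by (auto simp: init_state_def)
  show ?case
    unfolding run.simps real_run.simps init by (rule apply_op_of_real)
next
  case (Suc t)
  have "query_op n m x = (\<lambda>b b'. complex_of_real (query_mat n m x b b'))"
    by (simp add: query_op_eq fun_eq_iff)
  then show ?case by (simp only: run.simps apply_op_of_real real_run.simps Suc.IH)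
qed

lemma run_canon: "run n m W U (canon n m x) t = run n m W U x t"
proof (induction t)
  case (Suc t)
  have "query_op n m (canon n m x) b b' = query_op n m x b b'" if "b' \<in> qbasis n m W" for b b'
    using that by (auto simp: query_op_def canon_def qbasis_def)
  then show ?case by (simp add: Suc.IH apply_op_def)
qed simp

section \<open>From query kernels to algorithms\<close>

locale adversary_solution =
  fixes n m N :: nat
    and fp fr :: "cell \<Rightarrow> nat \<Rightarrow> input \<Rightarrow> real"
    and fa fb :: "nat \<Rightarrow> input \<Rightarrow> real"
  assumes n: "1 \<le> n" and m: "1 \<le> m" and N: "1 \<le> N"
begin

abbreviation "S \<equiv> sigma_size n m"
abbreviation "B \<equiv> qbasis n m (5 * N)"
abbreviation "P c x y \<equiv> (\<Sum>i<N. fp c i x * fp c i y)"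
abbreviation "R c x y \<equiv> (\<Sum>i<N. fr c i x * fr c i y)"
abbreviation "Acc x y \<equiv> (\<Sum>i<N. fa i x * fa i y)"
abbreviation "Rej x y \<equiv> (\<Sum>i<N. fb i x * fb i y)"

text \<open>The workspace index is \<open>5 * i + r\<close>, with \<open>r\<close> naming one of five blocks: the two kinds of
  query vectors, the accepting and the rejecting part of the target, and the start vector.  The
  last three are uniform over the query register and therefore invariant under queries.\<close>
definition vec :: "input \<Rightarrow> (cell \<Rightarrow> nat) \<Rightarrow> (cell \<Rightarrow> nat) \<Rightarrow> real \<Rightarrow> real \<Rightarrow> real \<Rightarrow> real \<Rightarrow> basis \<Rightarrow> real" where
  "vec x a b sv sa sb sx = (\<lambda>(c, p, w). let i = w div 5; r = w mod 5 in
     if r = 0 then of_bool (p = a c) * (sv * fp c i x)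
     else if r = 1 then of_bool (p = b c) * (sv * fr c i x)
     else if r = 2 then of_bool (c = (1, 1)) * (sa / sqrt S * fa i x)
     else if r = 3 then of_bool (c = (1, 1)) * (sb / sqrt S * fb i x)
     else of_bool (c = (1, 1)) * (of_bool (i = 0) * (sx / sqrt S)))"

lemma S_pos: "0 < S"
  by (simp add: sigma_size_def)

lemma start_cell: "(1, 1) \<in> grid n m"
  using n m by (simp add: grid_def)

lemma ip_vec:
  assumes "\<forall>c\<in>grid n m. a c < S" "\<forall>c\<in>grid n m. b c < S"
  shows "ip B (vec x a b sv sa sb sx) (vec y a' b' sv' sa' sb' sx') =
    sv * sv' * (\<Sum>c\<in>grid n m. of_bool (a c = a' c) * P c x y + of_bool (b c = b' c) * R c x y)
      + sa * sa' * Acc x y + sb * sb' * Rej x y + sx * sx'"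
proof -
  let ?f = "\<lambda>c p w. vec x a b sv sa sb sx (c, p, w) * vec y a' b' sv' sa' sb' sx' (c, p, w)"
  \<comment> \<open>The three query-invariant blocks live on one cell and are spread evenly over the
    \<open>S\<close> register values, each of which contributes \<open>Z\<close>.\<close>
  define Z where "Z = (sa * sa' * Acc x y + sb * sb' * Rej x y + sx * sx') / S"
  have sq: "sqrt (real S) * sqrt (real S) = real S" by simp
  have w: "(\<Sum>w<5*N. ?f c p w) =
      of_bool (p = a c) * (of_bool (p = a' c) * (sv * sv' * P c x y))
      + of_bool (p = b c) * (of_bool (p = b' c) * (sv * sv' * R c x y))
      + of_bool (c = (1, 1)) * Z" for c p
  proof -
    have "(\<Sum>w<5*N. ?f c p w) = (\<Sum>i<N.
        of_bool (p = a c) * (of_bool (p = a' c) * (sv * sv' * (fp c i x * fp c i y)))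
      + of_bool (p = b c) * (of_bool (p = b' c) * (sv * sv' * (fr c i x * fr c i y)))
      + of_bool (c = (1, 1)) * (sa * sa' / S * (fa i x * fa i y))
      + of_bool (c = (1, 1)) * (sb * sb' / S * (fb i x * fb i y))
      + of_bool (i = 0) * (of_bool (c = (1, 1)) * (sx * sx' / S)))"
      unfolding sum_lessThan_5_mult
    proof (intro sum.cong refl)
      fix i :: nat
      have d: "(5*i) div 5 = i" "(5*i+1) div 5 = i" "(5*i+2) div 5 = i" "(5*i+3) div 5 = i" "(5*i+4) div 5 = i"
        and r: "(5*i) mod 5 = 0" "(5*i+1) mod 5 = 1" "(5*i+2) mod 5 = 2" "(5*i+3) mod 5 = 3" "(5*i+4) mod 5 = 4"
        by presburger+
      have q: "u / sqrt (real S) * \<alpha> * (v / sqrt (real S) * \<beta>) = u * v / S * (\<alpha> * \<beta>)" for u v \<alpha> \<beta> :: real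
        by (simp add: sq times_divide_times_eq)
      have q': "u / sqrt (real S) * (v / sqrt (real S)) = u * v / S" for u v :: real
        by (simp add: sq times_divide_times_eq)
      have e: "?f c p (5*i) = of_bool (p = a c) * (of_bool (p = a' c) * (sv * sv' * (fp c i x * fp c i y)))"
        "?f c p (5*i+1) = of_bool (p = b c) * (of_bool (p = b' c) * (sv * sv' * (fr c i x * fr c i y)))"
        "?f c p (5*i+2) = of_bool (c = (1, 1)) * (sa * sa' / S * (fa i x * fa i y))"
        "?f c p (5*i+3) = of_bool (c = (1, 1)) * (sb * sb' / S * (fb i x * fb i y))"
        "?f c p (5*i+4) = of_bool (i = 0) * (of_bool (c = (1, 1)) * (sx * sx' / S))"
        unfolding vec_def prod.case d r Let_def by (auto simp: q q')
      show "?f c p (5*i) + ?f c p (5*i+1) + ?f c p (5*i+2) + ?f c p (5*i+3) + ?f c p (5*i+4) =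
        of_bool (p = a c) * (of_bool (p = a' c) * (sv * sv' * (fp c i x * fp c i y)))
      + of_bool (p = b c) * (of_bool (p = b' c) * (sv * sv' * (fr c i x * fr c i y)))
      + of_bool (c = (1, 1)) * (sa * sa' / S * (fa i x * fa i y))
      + of_bool (c = (1, 1)) * (sb * sb' / S * (fb i x * fb i y))
      + of_bool (i = 0) * (of_bool (c = (1, 1)) * (sx * sx' / S))"
        unfolding e ..
    qed
    also have "\<dots> = of_bool (p = a c) * (of_bool (p = a' c) * (sv * sv' * P c x y))
      + of_bool (p = b c) * (of_bool (p = b' c) * (sv * sv' * R c x y))
      + of_bool (c = (1, 1)) * (sa * sa' / S * Acc x y)
      + of_bool (c = (1, 1)) * (sb * sb' / S * Rej x y)
      + of_bool (c = (1, 1)) * (sx * sx' / S)"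
      using N by (simp only: sum.distrib sum_distrib_left [symmetric] sum_of_bool_mult finite_lessThan) simp
    also have "\<dots> = of_bool (p = a c) * (of_bool (p = a' c) * (sv * sv' * P c x y))
      + of_bool (p = b c) * (of_bool (p = b' c) * (sv * sv' * R c x y))
      + of_bool (c = (1, 1)) * Z"
      by (simp add: Z_def add_divide_distrib)
    finally show ?thesis .
  qed
  have p: "(\<Sum>p<S. \<Sum>w<5*N. ?f c p w) =
      sv * sv' * (of_bool (a c = a' c) * P c x y + of_bool (b c = b' c) * R c x y)
      + of_bool (c = (1, 1)) * (S * Z)" if "c \<in> grid n m" for c
  proof -
    have "(\<Sum>p<S. \<Sum>w<5*N. ?f c p w) =
        of_bool (a c \<in> {..<S}) * (of_bool (a c = a' c) * (sv * sv' * P c x y))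
        + of_bool (b c \<in> {..<S}) * (of_bool (b c = b' c) * (sv * sv' * R c x y))
        + S * (of_bool (c = (1, 1)) * Z)"
      unfolding w by (simp only: sum.distrib sum_of_bool_mult finite_lessThan sum_constant card_lessThan)
    then show ?thesis
      using assms that by (simp add: algebra_simps)
  qed
  have "ip B (vec x a b sv sa sb sx) (vec y a' b' sv' sa' sb' sx')
      = (\<Sum>c\<in>grid n m. \<Sum>p<S. \<Sum>w<5*N. ?f c p w)"
    by (simp add: ip_def qbasis_def sum.cartesian_product case_prod_beta)
  also have "\<dots> = (\<Sum>c\<in>grid n m. sv * sv' * (of_bool (a c = a' c) * P c x y + of_bool (b c = b' c) * R c x y)
      + of_bool (c = (1, 1)) * (S * Z))"
    by (intro sum.cong refl p)
  also have "\<dots> = sv * sv' * (\<Sum>c\<in>grid n m. of_bool (a c = a' c) * P c x y + of_bool (b c = b' c) * R c x y) + S * Z"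
    using start_cell by (simp only: sum.distrib sum_distrib_left [symmetric] sum_of_bool_mult finite_grid) simp
  finally show ?thesis
    using S_pos by (simp add: Z_def)
qed

definition code :: "input \<Rightarrow> cell \<Rightarrow> nat" where
  "code x c = sym_code n m (x c)"

definition neg_code :: "input \<Rightarrow> cell \<Rightarrow> nat" where
  "neg_code x c = (S - code x c) mod S"

lemma code_less: "x \<in> inputs n m \<Longrightarrow> c \<in> grid n m \<Longrightarrow> code x c < S"
  unfolding code_def by (intro sym_code_less) (simp add: inputs_def)

lemma register_bounds:
  "\<forall>c\<in>grid n m. 0 < S" "\<forall>c\<in>grid n m. neg_code x c < S"
  "x \<in> inputs n m \<Longrightarrow> \<forall>c\<in>grid n m. code x c < S"
  using S_pos code_less by (auto simp: neg_code_def)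

lemma code_eq_iff:
  "x \<in> inputs n m \<Longrightarrow> y \<in> inputs n m \<Longrightarrow> c \<in> grid n m \<Longrightarrow> code x c = code y c \<longleftrightarrow> x c = y c"
  unfolding code_def using sym_code_inj [of "x c" n m "y c"] by (auto simp: inputs_def)

lemma neg_code_eq_iff:
  assumes "x \<in> inputs n m" "y \<in> inputs n m" "c \<in> grid n m"
  shows "neg_code x c = neg_code y c \<longleftrightarrow> x c = y c"
proof -
  have "neg_code x c = neg_code y c \<longleftrightarrow> code x c = code y c"
    using code_less [OF assms(1,3)] code_less [OF assms(2,3)]
    by (auto simp: neg_code_def mod_if)
  then show ?thesis using code_eq_iff [OF assms] by simp
qed

text \<open>One query writes the symbol into the register of the \<open>P\<close> vectors and erases
  it from that of the \<open>R\<close> vectors. For a pair of inputs, the mask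
  \<open>x c = y c\<close> thereby moves from \<open>R\<close> to \<open>P\<close>, and this is the
  change of Gram matrix that the kernel identity describes.\<close>

lemma query_vec:
  assumes "x \<in> inputs n m" "b \<in> B"
  shows "mv B (query_mat n m x) (vec x (\<lambda>_. 0) (neg_code x) sv sa sb sx) b
       = vec x (code x) (\<lambda>_. 0) sv sa sb sx b"
proof -
  obtain c p w where b: "b = (c, p, w)" by (cases b)
  have c: "c \<in> grid n m" "p < S" using assms(2) by (auto simp: b qbasis_def)
  have k: "code x c < S" using assms(1) c(1) by (rule code_less)
  have "(p + (S - code x c)) mod S = 0 \<longleftrightarrow> p = code x c"
    unfolding mod_shift_nat(1) [OF c(2) k] using k by auto
  moreover have "(p + (S - code x c)) mod S = neg_code x c \<longleftrightarrow> p = 0"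
    unfolding mod_shift_nat(1) [OF c(2) k] neg_code_def using c(2) k by (auto simp: mod_if)
  ultimately show ?thesis
    unfolding b mv_query_mat [OF assms(1) assms(2) [unfolded b]]
    by (simp add: vec_def Let_def code_def)
qed

definition stage :: "nat \<Rightarrow> nat \<Rightarrow> input \<Rightarrow> basis \<Rightarrow> real" where
  "stage K t x = vec x (\<lambda>_. 0) (neg_code x) (1 / sqrt K) (sqrt (t / K)) (sqrt (t / K)) (sqrt (1 - t / K))"

text \<open>The states \<open>stage K t x\<close> interpolate between the start vector and the target, each with the
  query vectors scaled by \<open>1 / sqrt K\<close> as a catalyst.  By the kernel identity \<open>eq\<close> one query turns
  the Gram matrix of stage \<open>t\<close> into that of stage \<open>t + 1\<close>, so input-independent orthogonal matrices
  lead through all stages.  The actual algorithm starts without the catalyst, which costs a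
  constant error of squared norm at most \<open>L / K\<close>.\<close>
theorem computes_with:
  assumes eq: "\<And>x y. x \<in> canon_inputs n m \<Longrightarrow> y \<in> canon_inputs n m \<Longrightarrow>
      1 - Acc x y - Rej x y = (\<Sum>c\<in>grid n m. of_bool (x c \<noteq> y c) * (P c x y - R c x y))"
    and cost: "\<And>x. x \<in> canon_inputs n m \<Longrightarrow> (\<Sum>c\<in>grid n m. P c x x + R c x x) \<le> L"
    and accept: "\<And>x. x \<in> canon_inputs n m \<Longrightarrow> f x \<Longrightarrow> Rej x x = 0"
    and reject: "\<And>x. x \<in> canon_inputs n m \<Longrightarrow> \<not> f x \<Longrightarrow> Acc x x = 0"
    and canon: "\<And>x. x \<in> inputs n m \<Longrightarrow> f (canon n m x) = f x"
    and K: "1 \<le> K" "40 * L \<le> real K"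
  shows "computes_with n m f K"
proof -
  let ?D = "canon_inputs n m"
  have inp: "x \<in> inputs n m" if "x \<in> ?D" for x
    using that canon_inputs_subset by blast
  have sq: "sqrt (real t / real K) * sqrt (real t / real K) = t / K" for t :: nat
    by simp
  have Kinv: "1 / sqrt (real K) * (1 / sqrt (real K)) = 1 / K"
    by simp
  have norm1: "Acc x x + Rej x x = 1" if "x \<in> ?D" for x
    using eq [OF that that] by simp
  have cost0: "0 \<le> (\<Sum>c\<in>grid n m. P c x x + R c x x)" for x
    by (intro sum_nonneg add_nonneg_nonneg) auto
  \<comment> \<open>The input argument is immaterial: the only block with a nonzero scale does not
    depend on it.\<close>
  define e where "e = vec undefined (\<lambda>_. 0) (\<lambda>_. 0) 0 0 0 1"
  define init where "init = (\<lambda>b :: basis. of_bool (b = ((1, 1), 0, 0)) :: real)"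
  have init_mem: "((1, 1), 0, 0) \<in> B"
    using start_cell S_pos N by (simp add: qbasis_def)
  have "ip B init init = 1"
    unfolding ip_def init_def using init_mem by (subst sum_of_bool_mult) (auto simp: finite_qbasis)
  moreover have "ip B e e = 1"
    unfolding e_def by (subst ip_vec) (simp_all add: S_pos)
  ultimately obtain V0 where V0: "orth B V0" "\<And>b. b \<in> B \<Longrightarrow> mv B V0 init b = e b"
    using equal_gram_imp_orth [of "{()}" B "\<lambda>_. init" "\<lambda>_. e"] by (auto simp: finite_qbasis)
  have "\<exists>V. orth B V \<and> (\<forall>x\<in>?D. \<forall>b\<in>B. mv B V (mv B (query_mat n m x) (stage K t x)) b = stage K (Suc t) x b)"
    if "t < K" for t
  proof (rule equal_gram_imp_orth)
    fix x y assume xy: "x \<in> ?D" "y \<in> ?D"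
    let ?s = "sqrt (t / K)" and ?s' = "sqrt (1 - t / K)"
    let ?u = "sqrt (Suc t / K)" and ?u' = "sqrt (1 - Suc t / K)"
    have le: "real t / K \<le> 1" "real (Suc t) / K \<le> 1"
      using that by (simp_all add: divide_le_eq_1)
    have sq': "?s' * ?s' = 1 - t / K" "?u' * ?u' = 1 - Suc t / K"
      using le by (simp_all del: of_nat_Suc)
    have "ip B (mv B (query_mat n m x) (stage K t x)) (mv B (query_mat n m y) (stage K t y))
        = ip B (vec x (code x) (\<lambda>_. 0) (1 / sqrt K) ?s ?s ?s') (vec y (code y) (\<lambda>_. 0) (1 / sqrt K) ?s ?s ?s')"
      unfolding stage_def by (intro ip_cong query_vec inp xy)
    also have "\<dots> = 1 / K * (\<Sum>c\<in>grid n m. of_bool (x c = y c) * P c x y + R c x y)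
        + t / K * (Acc x y + Rej x y) + (1 - t / K)"
      unfolding ip_vec [OF register_bounds(3) [OF inp [OF xy(1)]] register_bounds(1)] Kinv sq sq'
      using code_eq_iff [OF inp inp, OF xy] by (simp add: distrib_left)
    finally have L: "ip B (mv B (query_mat n m x) (stage K t x)) (mv B (query_mat n m y) (stage K t y))
        = 1 / K * (\<Sum>c\<in>grid n m. of_bool (x c = y c) * P c x y + R c x y)
        + t / K * (Acc x y + Rej x y) + (1 - t / K)" .
    have R: "ip B (stage K (Suc t) x) (stage K (Suc t) y)
        = 1 / K * (\<Sum>c\<in>grid n m. P c x y + of_bool (x c = y c) * R c x y)
        + Suc t / K * (Acc x y + Rej x y) + (1 - Suc t / K)"
      unfolding stage_def ip_vec [OF register_bounds(1,2)] Kinv sq sq'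
      using neg_code_eq_iff [OF inp inp, OF xy] by (simp add: distrib_left del: of_nat_Suc)
    have "(\<Sum>c\<in>grid n m. P c x y + of_bool (x c = y c) * R c x y)
        - (\<Sum>c\<in>grid n m. of_bool (x c = y c) * P c x y + R c x y)
        = (\<Sum>c\<in>grid n m. (P c x y + of_bool (x c = y c) * R c x y) - (of_bool (x c = y c) * P c x y + R c x y))"
      by (rule sum_subtractf [symmetric])
    also have "\<dots> = 1 - Acc x y - Rej x y"
      unfolding eq [OF xy] by (intro sum.cong) auto
    finally have "(\<Sum>c\<in>grid n m. P c x y + of_bool (x c = y c) * R c x y)
        - (\<Sum>c\<in>grid n m. of_bool (x c = y c) * P c x y + R c x y) = 1 - Acc x y - Rej x y" .
    then have "1 / K * (\<Sum>c\<in>grid n m. P c x y + of_bool (x c = y c) * R c x y)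
        - 1 / K * (\<Sum>c\<in>grid n m. of_bool (x c = y c) * P c x y + R c x y) = 1 / K * (1 - Acc x y - Rej x y)"
      by (simp only: right_diff_distrib [symmetric])
    moreover have "Suc t / K = t / K + 1 / K"
      by (simp add: add_divide_distrib)
    ultimately show "ip B (mv B (query_mat n m x) (stage K t x)) (mv B (query_mat n m y) (stage K t y))
        = ip B (stage K (Suc t) x) (stage K (Suc t) y)"
      unfolding L R by (simp add: algebra_simps)
  qed (simp_all add: finite_canon_inputs finite_qbasis)
  then obtain V1 where V1: "\<And>t. t < K \<Longrightarrow> orth B (V1 t)"
      "\<And>t x b. t < K \<Longrightarrow> x \<in> ?D \<Longrightarrow> b \<in> B \<Longrightarrow>
        mv B (V1 t) (mv B (query_mat n m x) (stage K t x)) b = stage K (Suc t) x b"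
    by metis
  define V where "V t = (case t of 0 \<Rightarrow> V0 | Suc t \<Rightarrow> V1 t)" for t
  have orth_V: "orth B (V t)" if "t \<le> K" for t
    using that V0(1) V1(1) by (cases t) (auto simp: V_def)
  let ?r = "real_run n m (5 * N) V"
  have ip_run: "ip B (?r x t) (?r x t) = 1" if x: "x \<in> ?D" and "t \<le> K" for x t
    using that(2)
  proof (induction t)
    case 0
    then show ?case
      using orth_V [of 0] \<open>ip B init init = 1\<close> by (simp add: ip_mv finite_qbasis init_def)
  next
    case (Suc t)
    then show ?case
      using orth_V orth_query_mat [OF inp [OF x]] by (simp add: ip_mv finite_qbasis)
  qed
  \<comment> \<open>At time 0 the run differs from the stage exactly by the catalyst. Afterwards
    both undergo the same orthogonal maps, so the distance never grows.\<close>
  have diff: "ip B (\<lambda>b. stage K t x b - ?r x t b) (\<lambda>b. stage K t x b - ?r x t b) \<le> L / K"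
    if x: "x \<in> ?D" and "t \<le> K" for x t
    using that(2)
  proof (induction t)
    case 0
    have "ip B (\<lambda>b. stage K 0 x b - ?r x 0 b) (\<lambda>b. stage K 0 x b - ?r x 0 b)
        = ip B (vec x (\<lambda>_. 0) (neg_code x) (1 / sqrt K) 0 0 0) (vec x (\<lambda>_. 0) (neg_code x) (1 / sqrt K) 0 0 0)"
    proof (intro ip_cong)
      show "stage K 0 x b - ?r x 0 b = vec x (\<lambda>_. 0) (neg_code x) (1 / sqrt K) 0 0 0 b" if "b \<in> B" for b
      proof -
        have "?r x 0 b = e b"
          using V0(2) [OF that] by (simp only: real_run.simps V_def init_def nat.case)
        then show ?thesis
          by (cases b) (simp add: stage_def e_def vec_def Let_def)
      qed
      then show "stage K 0 x b - ?r x 0 b = vec x (\<lambda>_. 0) (neg_code x) (1 / sqrt K) 0 0 0 b" if "b \<in> B" for b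
        using that .
    qed
    also have "\<dots> = 1 / K * (\<Sum>c\<in>grid n m. P c x x + R c x x)"
      unfolding ip_vec [OF register_bounds(1,2)] Kinv by simp
    also have "\<dots> \<le> L / K"
      using cost [OF x] by (simp add: divide_right_mono)
    finally show ?case .
  next
    case (Suc t)
    let ?d = "\<lambda>b. stage K t x b - ?r x t b"
    have "stage K (Suc t) x b - ?r x (Suc t) b = mv B (V (Suc t)) (mv B (query_mat n m x) ?d) b"
      if "b \<in> B" for b
      using V1(2) [of t x b] Suc.prems x that
      by (simp add: V_def mv_diff [abs_def])
    then have "ip B (\<lambda>b. stage K (Suc t) x b - ?r x (Suc t) b) (\<lambda>b. stage K (Suc t) x b - ?r x (Suc t) b)
        = ip B (mv B (V (Suc t)) (mv B (query_mat n m x) ?d)) (mv B (V (Suc t)) (mv B (query_mat n m x) ?d))"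
      by (intro ip_cong)
    also have "\<dots> = ip B ?d ?d"
      using orth_V [OF Suc.prems] orth_query_mat [OF inp [OF x]] by (simp add: ip_mv finite_qbasis)
    finally show ?case using Suc by simp
  qed
  \<comment> \<open>Only the accepting target block counts as acceptance. The leftover catalyst lies
    in the rejecting set, so only positive inputs pay for it in \<open>\<phi>\<close>.\<close>
  define A where "A = {(c, p, w) \<in> B. w mod 5 = 2}"
  have wrong: "(\<Sum>b\<in>{b\<in>B. (b \<in> A) \<noteq> f x}. (?r x K b)\<^sup>2) \<le> 1 / 10" if x: "x \<in> ?D" for x
  proof -
    let ?W = "{b\<in>B. (b \<in> A) \<noteq> f x}" and ?d = "\<lambda>b. stage K K x b - ?r x K b"
    have fin: "finite ?W" "?W \<subseteq> B" by (auto simp: finite_qbasis)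
    \<comment> \<open>\<open>\<phi>\<close> agrees with the final stage on the wrong set. For a
      positive input only the catalyst survives in it, since \<open>Rej x x = 0\<close>; for a
      negative input nothing does, since \<open>Acc x x = 0\<close>.\<close>
    have "\<exists>\<phi>. (\<forall>b\<in>?W. stage K K x b = \<phi> b) \<and> ip B \<phi> \<phi> \<le> L / K"
    proof (cases "f x")
      case True
      let ?\<phi> = "vec x (\<lambda>_. 0) (neg_code x) (1 / sqrt K) 0 1 0"
      have "\<forall>b\<in>?W. stage K K x b = ?\<phi> b"
      proof
        fix b assume b: "b \<in> ?W"
        obtain c p w where cpw: "b = (c, p, w)" by (cases b)
        have "w mod 5 \<noteq> 2" using b True by (auto simp: A_def cpw)
        then show "stage K K x b = ?\<phi> b"
          using K(1) by (simp add: stage_def vec_def Let_def cpw)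
      qed
      moreover have "ip B ?\<phi> ?\<phi> = 1 / K * (\<Sum>c\<in>grid n m. P c x x + R c x x)"
        unfolding ip_vec [OF register_bounds(1,2)] Kinv using accept [OF x True] by simp
      moreover have "1 / K * (\<Sum>c\<in>grid n m. P c x x + R c x x) \<le> L / K"
        using cost [OF x] by (simp add: divide_right_mono)
      ultimately show ?thesis
        by - (rule exI [of _ ?\<phi>], rule conjI, assumption, linarith)
    next
      case False
      let ?\<phi> = "vec x (\<lambda>_. 0) (neg_code x) 0 1 0 0"
      have "\<forall>b\<in>?W. stage K K x b = ?\<phi> b"
      proof
        fix b assume b: "b \<in> ?W"
        obtain c p w where cpw: "b = (c, p, w)" by (cases b)
        have "w mod 5 = 2" using b False by (auto simp: A_def cpw)
        then show "stage K K x b = ?\<phi> b"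
          using K(1) by (simp add: stage_def vec_def Let_def cpw)
      qed
      moreover have "ip B ?\<phi> ?\<phi> = 0"
        unfolding ip_vec [OF register_bounds(1,2)] using reject [OF x False] by simp
      moreover have "0 \<le> L / K"
        using cost [OF x] cost0 [of x] by simp
      ultimately show ?thesis
        by - (rule exI [of _ ?\<phi>], rule conjI, assumption, linarith)
    qed
    then obtain \<phi> where \<phi>: "\<And>b. b \<in> ?W \<Longrightarrow> stage K K x b = \<phi> b" "ip B \<phi> \<phi> \<le> L / K"
      by blast
    \<comment> \<open>On the wrong set the run is \<open>\<phi>\<close> minus the drift, each of
      squared norm at most \<open>L / K\<close>. The factor 2 for the square of a difference gives
      \<open>4 * (L / K)\<close>, which is why \<open>40 * L \<le> K\<close> yields error
      1/10.\<close>
    have "(\<Sum>b\<in>?W. (?r x K b)\<^sup>2) \<le> (\<Sum>b\<in>?W. 2 * (\<phi> b * \<phi> b) + 2 * (?d b * ?d b))"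
    proof (rule sum_mono)
      fix b assume "b \<in> ?W"
      then have "stage K K x b = \<phi> b" by (rule \<phi>(1))
      then have "?r x K b = \<phi> b - ?d b" by linarith
      then have "(?r x K b)\<^sup>2 = (\<phi> b - ?d b)\<^sup>2" by simp
      also have "\<dots> \<le> (\<phi> b - ?d b)\<^sup>2 + (\<phi> b + ?d b)\<^sup>2" by simp
      also have "\<dots> = 2 * (\<phi> b * \<phi> b) + 2 * (?d b * ?d b)"
        by (simp add: power2_eq_square algebra_simps)
      finally show "(?r x K b)\<^sup>2 \<le> 2 * (\<phi> b * \<phi> b) + 2 * (?d b * ?d b)" .
    qed
    also have "\<dots> \<le> (\<Sum>b\<in>B. 2 * (\<phi> b * \<phi> b) + 2 * (?d b * ?d b))"
      by (rule sum_mono2) (use fin in \<open>auto simp: finite_qbasis\<close>)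
    also have "\<dots> = 2 * ip B \<phi> \<phi> + 2 * ip B ?d ?d"
      by (simp only: sum.distrib sum_distrib_left [symmetric] ip_def)
    also have "\<dots> \<le> 4 * (L / K)"
      using \<phi>(2) diff [OF x order_refl] by linarith
    also have "\<dots> \<le> 1 / 10"
      using K by (simp add: field_simps)
    finally show ?thesis .
  qed
  let ?U = "\<lambda>t b b'. complex_of_real (V t b b')"
  have prob: "9 / 10 \<le> prob_output n m (5 * N) ?U A K x (f x)" if x: "x \<in> ?D" for x
  proof -
    have split: "B = {b\<in>B. (b \<in> A) = f x} \<union> {b\<in>B. (b \<in> A) \<noteq> f x}"
      by blast
    have "1 = (\<Sum>b\<in>B. (?r x K b)\<^sup>2)"
      using ip_run [OF x order_refl] by (simp only: ip_def power2_eq_square)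
    also have "\<dots> = (\<Sum>b\<in>{b\<in>B. (b \<in> A) = f x} \<union> {b\<in>B. (b \<in> A) \<noteq> f x}. (?r x K b)\<^sup>2)"
      by (rule arg_cong [where f = "sum _", OF split])
    also have "\<dots> = (\<Sum>b\<in>{b\<in>B. (b \<in> A) = f x}. (?r x K b)\<^sup>2) + (\<Sum>b\<in>{b\<in>B. (b \<in> A) \<noteq> f x}. (?r x K b)\<^sup>2)"
      by (intro sum.union_disjoint) (auto simp: finite_qbasis)
    finally have "9 / 10 \<le> (\<Sum>b\<in>{b\<in>B. (b \<in> A) = f x}. (?r x K b)\<^sup>2)"
      using wrong [OF x] by linarith
    also have "\<dots> = prob_output n m (5 * N) ?U A K x (f x)"
      unfolding prob_output_def run_of_real by (simp only: norm_of_real power2_abs)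
    finally show ?thesis .
  qed
  have "9 / 10 \<le> prob_output n m (5 * N) ?U A K x (f x)" if "x \<in> inputs n m" for x
    using prob [OF canon_in_canon_inputs [OF that]]
    unfolding canon [OF that] prob_output_def run_canon .
  moreover have "\<forall>t\<le>K. unitary_on B (?U t)"
    using orth_V by (intro allI impI unitary_on_of_real)
  moreover have "A \<subseteq> B" by (auto simp: A_def)
  moreover have "0 < 5 * N" using N by simp
  ultimately have "0 < 5 * N \<and> (\<forall>t\<le>K. unitary_on B (?U t)) \<and> A \<subseteq> B \<and>
      (\<forall>x\<in>inputs n m. 9 / 10 \<le> prob_output n m (5 * N) ?U A K x (f x))"
    by simp
  then show ?thesis
    unfolding computes_with_def by - (rule exI, rule exI, rule exI)
qed

end

theorem computes_with_qker:
  assumes "1 \<le> n" "1 \<le> m" "psd A" "psd A'"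
    and "canon.qker n m (\<lambda>x y. 1 - A x y - A' x y) (\<lambda>_. L)"
    and "\<And>x. x \<in> canon_inputs n m \<Longrightarrow> f x \<Longrightarrow> A' x x = 0"
    and "\<And>x. x \<in> canon_inputs n m \<Longrightarrow> \<not> f x \<Longrightarrow> A x x = 0"
    and "\<And>x. x \<in> inputs n m \<Longrightarrow> f (canon n m x) = f x"
    and "1 \<le> K" "40 * L \<le> real K"
  shows "computes_with n m f K"
proof -
  obtain P R where "\<forall>c\<in>grid n m. psd (P c) \<and> psd (R c)"
    "\<forall>x\<in>canon_inputs n m. \<forall>y\<in>canon_inputs n m. 1 - A x y - A' x y =
        (\<Sum>c\<in>grid n m. of_bool (x c \<noteq> y c) * (P c x y - R c x y))"
    "\<forall>x\<in>canon_inputs n m. (\<Sum>c\<in>grid n m. P c x x + R c x x) \<le> L"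
    using assms(5) unfolding canon.qker_def by blast
  then have PR:
    "\<And>c. c \<in> grid n m \<Longrightarrow> psd (P c)" "\<And>c. c \<in> grid n m \<Longrightarrow> psd (R c)"
    "\<And>x y. x \<in> canon_inputs n m \<Longrightarrow> y \<in> canon_inputs n m \<Longrightarrow> 1 - A x y - A' x y =
        (\<Sum>c\<in>grid n m. of_bool (x c \<noteq> y c) * (P c x y - R c x y))"
    "\<And>x. x \<in> canon_inputs n m \<Longrightarrow> (\<Sum>c\<in>grid n m. P c x x + R c x x) \<le> L"
    by blast+
  obtain Na :: nat where Na: "\<And>N. N \<ge> Na \<Longrightarrow> \<exists>g. \<forall>x y. A x y = (\<Sum>i<N. g i x * g i y)"
    using psd_imp_gram [OF assms(3)] by auto
  obtain Nb :: nat where Nb: "\<And>N. N \<ge> Nb \<Longrightarrow> \<exists>g. \<forall>x y. A' x y = (\<Sum>i<N. g i x * g i y)"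
    using psd_imp_gram [OF assms(4)] by auto
  have "\<forall>c. \<exists>N0::nat. c \<in> grid n m \<longrightarrow> (\<forall>N\<ge>N0. \<exists>g. \<forall>x y. P c x y = (\<Sum>i<N. g i x * g i y))"
    using psd_imp_gram [OF PR(1)] by blast
  from choice [OF this] obtain Np :: "cell \<Rightarrow> nat" where
    Np: "\<And>c N. c \<in> grid n m \<Longrightarrow> N \<ge> Np c \<Longrightarrow> \<exists>g. \<forall>x y. P c x y = (\<Sum>i<N. g i x * g i y)"
    by blast
  have "\<forall>c. \<exists>N0::nat. c \<in> grid n m \<longrightarrow> (\<forall>N\<ge>N0. \<exists>g. \<forall>x y. R c x y = (\<Sum>i<N. g i x * g i y))"
    using psd_imp_gram [OF PR(2)] by blast
  from choice [OF this] obtain Nr :: "cell \<Rightarrow> nat" where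
    Nr: "\<And>c N. c \<in> grid n m \<Longrightarrow> N \<ge> Nr c \<Longrightarrow> \<exists>g. \<forall>x y. R c x y = (\<Sum>i<N. g i x * g i y)"
    by blast
  \<comment> \<open>The sum dominates every single dimension; the summand 1 guarantees the index
    \<open>i = 0\<close> that carries the start vector.\<close>
  define N where "N = 1 + Na + Nb + (\<Sum>c\<in>grid n m. Np c + Nr c)"
  have N: "Np c \<le> N" "Nr c \<le> N" if "c \<in> grid n m" for c
    using member_le_sum [OF that, of "\<lambda>c. Np c + Nr c"] by (auto simp: N_def finite_grid)
  obtain fa where fa: "\<And>x y. A x y = (\<Sum>i<N. fa i x * fa i y)"
    using Na [of N] by (auto simp: N_def)
  obtain fb where fb: "\<And>x y. A' x y = (\<Sum>i<N. fb i x * fb i y)"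
    using Nb [of N] by (auto simp: N_def)
  have "\<forall>c. \<exists>g. c \<in> grid n m \<longrightarrow> (\<forall>x y. P c x y = (\<Sum>i<N. g i x * g i y))"
    using Np N(1) by blast
  from choice [OF this] obtain fp where
    fp: "\<And>c x y. c \<in> grid n m \<Longrightarrow> P c x y = (\<Sum>i<N. fp c i x * fp c i y)"
    by blast
  have "\<forall>c. \<exists>g. c \<in> grid n m \<longrightarrow> (\<forall>x y. R c x y = (\<Sum>i<N. g i x * g i y))"
    using Nr N(2) by blast
  from choice [OF this] obtain fr where
    fr: "\<And>c x y. c \<in> grid n m \<Longrightarrow> R c x y = (\<Sum>i<N. fr c i x * fr c i y)"
    by blast
  interpret adversary_solution n m N fp fr fa fb
    by unfold_locales (use assms in \<open>auto simp: N_def\<close>)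
  show ?thesis
  proof (rule computes_with)
    show "1 - (\<Sum>i<N. fa i x * fa i y) - (\<Sum>i<N. fb i x * fb i y) =
        (\<Sum>c\<in>grid n m. of_bool (x c \<noteq> y c) * ((\<Sum>i<N. fp c i x * fp c i y) - (\<Sum>i<N. fr c i x * fr c i y)))"
      if "x \<in> canon_inputs n m" "y \<in> canon_inputs n m" for x y
      using PR(3) [OF that] by (simp add: fa fb fp fr)
    show "(\<Sum>c\<in>grid n m. (\<Sum>i<N. fp c i x * fp c i x) + (\<Sum>i<N. fr c i x * fr c i x)) \<le> L"
      if "x \<in> canon_inputs n m" for x
      using PR(4) [OF that] by (simp add: fp fr)
  qed (use assms(6-) in \<open>auto simp: fa fb\<close>)
qed

section \<open>Checking a special cell\<close>

lemma leaf_paths_grow: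
  "snd (grow t e) = e - length (leaf_paths t) \<and>
   length (leaf_paths (fst (grow t e))) = length (leaf_paths t) + min e (length (leaf_paths t))"
proof (induction t arbitrary: e)
  case (Node l r)
  obtain l' e1 where l: "grow l e = (l', e1)" by fastforce
  obtain r' e2 where r: "grow r e1 = (r', e2)" by fastforce
  have "grow (Node l r) e = (Node l' r', e2)" by (simp add: l r Let_def)
  then show ?case
    using Node.IH(1) [of e, unfolded l] Node.IH(2) [of e1, unfolded r]
    by (auto simp: min_def)
qed simp

lemma leaf_paths_grow_depth:
  assumes "\<forall>p\<in>set (leaf_paths t). length p \<le> d"
  shows "\<forall>p\<in>set (leaf_paths (fst (grow t e))). length p \<le> Suc d"
  using assms
proof (induction t arbitrary: d e)
  case (Node l r)
  obtain d' where d: "d = Suc d'"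
  proof (cases d)
    case 0
    have "leaf_paths l \<noteq> []" by (induction l) auto
    then show ?thesis using Node.prems 0 by (cases "leaf_paths l") auto
  qed
  have lr: "\<forall>p\<in>set (leaf_paths l). length p \<le> d'" "\<forall>p\<in>set (leaf_paths r). length p \<le> d'"
    using Node.prems by (simp_all add: d ball_Un)
  obtain l' e1 where l: "grow l e = (l', e1)" by fastforce
  obtain r' e2 where r: "grow r e1 = (r', e2)" by fastforce
  show ?case
    using Node.IH(1) [OF lr(1), of e] Node.IH(2) [OF lr(2), of e1]
    by (auto simp: d l r Let_def)
qed simp

lemma leaf_paths_complete_tree:
  "length (leaf_paths (complete_tree d)) = 2 ^ d \<and> (\<forall>p\<in>set (leaf_paths (complete_tree d)). length p \<le> d)"
  by (induction d) auto

text \<open>With \<open>r = floor_log m\<close> the surplus \<open>m - 2 ^ r\<close> is smaller than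
  \<open>2 ^ r\<close>, so each unit of it finds a leaf to split. The tree then has exactly
  \<open>m\<close> leaves, the index \<open>j - 1\<close> is in range, and growing adds at most one
  level.\<close>

lemma length_Tpath:
  assumes "1 \<le> j" "j \<le> m"
  shows "length (Tpath m j) \<le> floor_log m + 1"
proof -
  let ?r = "floor_log m"
  have "2 ^ ?r \<le> m" "m < 2 * 2 ^ ?r"
    using assms floor_log_exp2_le [of m] floor_log_exp2_gt [of m] by auto
  then have "length (leaf_paths (tree_T m)) = m"
    using leaf_paths_grow [of "complete_tree ?r" "m - 2 ^ ?r"] leaf_paths_complete_tree [of ?r]
    by (simp add: tree_T_def Let_def)
  then have "Tpath m j \<in> set (leaf_paths (tree_T m))"
    unfolding Tpath_def using assms by (intro nth_mem) auto
  then show ?thesis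
    using leaf_paths_grow_depth [of "complete_tree ?r" ?r "m - 2 ^ ?r"] leaf_paths_complete_tree [of ?r]
    by (simp add: tree_T_def Let_def)
qed

section \<open>Witnesses of \<open>h\<close>, and its independence of symbols outside the
  grid\<close>

abbreviation "blank \<equiv> (True, None, None, None)"

lemma pointers_in_grid:
  assumes "x \<in> inputs n m" "c \<in> grid n m"
  shows "lpoint (x c) = Some c' \<Longrightarrow> c' \<in> grid n m"
    and "rpoint (x c) = Some c' \<Longrightarrow> c' \<in> grid n m"
    and "ipoint (x c) = Some c' \<Longrightarrow> c' \<in> grid n m"
proof -
  have "x c \<in> Sigma n m"
    using assms unfolding inputs_def by blast
  then have "valid_ptr n m (lpoint (x c)) \<and> valid_ptr n m (rpoint (x c)) \<and> valid_ptr n m (ipoint (x c))"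
    by (cases "x c") (simp only: Sigma_def lpoint_def rpoint_def ipoint_def mem_Collect_eq prod.case fst_conv snd_conv)
  then show "lpoint (x c) = Some c' \<Longrightarrow> c' \<in> grid n m"
    "rpoint (x c) = Some c' \<Longrightarrow> c' \<in> grid n m"
    "ipoint (x c) = Some c' \<Longrightarrow> c' \<in> grid n m"
    unfolding valid_ptr_def by simp_all
qed

lemma follow_in_grid:
  assumes "x \<in> inputs n m" "c \<in> grid n m" "follow x c ds = Some l"
  shows "l \<in> grid n m"
  using assms(2,3)
proof (induction ds arbitrary: c)
  case (Cons d ds)
  then obtain c' where c': "(if d then rpoint (x c) else lpoint (x c)) = Some c'" "follow x c' ds = Some l"
    by (auto split: option.splits)
  then have "c' \<in> grid n m"
    using pointers_in_grid(1,2) [OF assms(1) Cons.prems(1)] by (cases d) simp_all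
  then show ?case using c'(2) by (rule Cons.IH)
qed simp

lemma follow_cong:
  assumes "x \<in> inputs n m" "\<And>c. c \<in> grid n m \<Longrightarrow> y c = x c" "c \<in> grid n m"
  shows "follow y c ds = follow x c ds"
  using assms(3)
proof (induction ds arbitrary: c)
  case (Cons d ds)
  let ?p = "if d then rpoint (x c) else lpoint (x c)"
  show ?case
  proof (cases ?p)
    case None
    then show ?thesis by (cases d) (simp_all add: assms(2) [OF Cons.prems])
  next
    case (Some c')
    then have "c' \<in> grid n m"
      using pointers_in_grid(1,2) [OF assms(1) Cons.prems] by (cases d) simp_all
    then show ?thesis
      using Some by (cases d) (simp_all add: assms(2) [OF Cons.prems] Cons.IH)
  qed
qed simp

definition h_witness :: "nat \<Rightarrow> nat \<Rightarrow> nat \<Rightarrow> input \<Rightarrow> (nat \<Rightarrow> nat) \<Rightarrow> (nat \<Rightarrow> cell) \<Rightarrow> bool" where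
  "h_witness k n m x b a \<longleftrightarrow> bij_betw b {1..k} (marked_cols n m x) \<and>
     (\<forall>s\<in>{1..k}. a s \<in> grid n m \<and> snd (a s) = b s \<and>
        (\<forall>i\<in>{1..n}. (x (i, b s) \<noteq> blank) \<longleftrightarrow> (i, b s) = a s)) \<and>
     (\<forall>s\<in>{1..<k}. ipoint (x (a s)) = Some (a (Suc s))) \<and>
     ipoint (x (a k)) = Some (a 1) \<and>
     (\<forall>s\<in>{1..k}. \<forall>t\<in>{1..k}. lpoint (x (a s)) = lpoint (x (a t)) \<and> rpoint (x (a s)) = rpoint (x (a t))) \<and>
     (\<forall>j\<in>{1..m} - marked_cols n m x. \<forall>s\<in>{1..k}.
        \<exists>l. follow x (a s) (Tpath m j) = Some l \<and> snd l = j \<and> \<not> val (x l))"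

lemma h_iff_witness: "h k n m x \<longleftrightarrow> (\<exists>b a. h_witness k n m x b a)"
  by (simp only: h_def h_witness_def)

lemma hI:
  assumes "bij_betw b {1..k} (marked_cols n m x)"
    and "\<And>s. s \<in> {1..k} \<Longrightarrow> a s \<in> grid n m"
    and "\<And>s. s \<in> {1..k} \<Longrightarrow> snd (a s) = b s"
    and "\<And>s i. s \<in> {1..k} \<Longrightarrow> i \<in> {1..n} \<Longrightarrow> (x (i, b s) \<noteq> blank) \<longleftrightarrow> (i, b s) = a s"
    and "\<And>s. s \<in> {1..<k} \<Longrightarrow> ipoint (x (a s)) = Some (a (Suc s))" "ipoint (x (a k)) = Some (a 1)"
    and "\<And>s t. s \<in> {1..k} \<Longrightarrow> t \<in> {1..k} \<Longrightarrow>
        lpoint (x (a s)) = lpoint (x (a t)) \<and> rpoint (x (a s)) = rpoint (x (a t))"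
    and "\<And>j s. j \<in> {1..m} - marked_cols n m x \<Longrightarrow> s \<in> {1..k} \<Longrightarrow>
        \<exists>l. follow x (a s) (Tpath m j) = Some l \<and> snd l = j \<and> \<not> val (x l)"
  shows "h k n m x"
proof -
  have "\<forall>s\<in>{1..k}. a s \<in> grid n m \<and> snd (a s) = b s \<and>
        (\<forall>i\<in>{1..n}. (x (i, b s) \<noteq> blank) \<longleftrightarrow> (i, b s) = a s)"
    by (intro ballI conjI assms(2-4))
  moreover have "\<forall>s\<in>{1..<k}. ipoint (x (a s)) = Some (a (Suc s))"
    by (intro ballI assms(5))
  moreover have "\<forall>s\<in>{1..k}. \<forall>t\<in>{1..k}. lpoint (x (a s)) = lpoint (x (a t)) \<and> rpoint (x (a s)) = rpoint (x (a t))"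
    by (intro ballI assms(7))
  moreover have "\<forall>j\<in>{1..m} - marked_cols n m x. \<forall>s\<in>{1..k}.
        \<exists>l. follow x (a s) (Tpath m j) = Some l \<and> snd l = j \<and> \<not> val (x l)"
    by (intro ballI assms(8))
  ultimately have "h_witness k n m x b a"
    unfolding h_witness_def using assms(1,6) by - (intro conjI; assumption)
  then show ?thesis unfolding h_iff_witness by blast
qed

lemma h_witnessD:
  assumes "h_witness k n m x b a"
  shows "bij_betw b {1..k} (marked_cols n m x)"
    and "s \<in> {1..k} \<Longrightarrow> a s \<in> grid n m"
    and "s \<in> {1..k} \<Longrightarrow> snd (a s) = b s"
    and "s \<in> {1..k} \<Longrightarrow> i \<in> {1..n} \<Longrightarrow> (x (i, b s) \<noteq> blank) \<longleftrightarrow> (i, b s) = a s"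
    and "s \<in> {1..<k} \<Longrightarrow> ipoint (x (a s)) = Some (a (Suc s))"
    and "ipoint (x (a k)) = Some (a 1)"
    and "s \<in> {1..k} \<Longrightarrow> t \<in> {1..k} \<Longrightarrow>
        lpoint (x (a s)) = lpoint (x (a t)) \<and> rpoint (x (a s)) = rpoint (x (a t))"
    and "j \<in> {1..m} - marked_cols n m x \<Longrightarrow> s \<in> {1..k} \<Longrightarrow>
        \<exists>l. follow x (a s) (Tpath m j) = Some l \<and> snd l = j \<and> \<not> val (x l)"
proof -
  have h: "bij_betw b {1..k} (marked_cols n m x)"
    "\<forall>s\<in>{1..k}. a s \<in> grid n m \<and> snd (a s) = b s \<and>
        (\<forall>i\<in>{1..n}. (x (i, b s) \<noteq> blank) \<longleftrightarrow> (i, b s) = a s)"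
    "\<forall>s\<in>{1..<k}. ipoint (x (a s)) = Some (a (Suc s))"
    "ipoint (x (a k)) = Some (a 1)"
    "\<forall>s\<in>{1..k}. \<forall>t\<in>{1..k}. lpoint (x (a s)) = lpoint (x (a t)) \<and> rpoint (x (a s)) = rpoint (x (a t))"
    "\<forall>j\<in>{1..m} - marked_cols n m x. \<forall>s\<in>{1..k}.
        \<exists>l. follow x (a s) (Tpath m j) = Some l \<and> snd l = j \<and> \<not> val (x l)"
    using assms unfolding h_witness_def by - (elim conjE, assumption)+
  show "bij_betw b {1..k} (marked_cols n m x)" "ipoint (x (a k)) = Some (a 1)"
    by (rule h)+
  show "s \<in> {1..k} \<Longrightarrow> a s \<in> grid n m"
    by (rule conjunct1 [OF bspec [OF h(2)]])
  show "s \<in> {1..k} \<Longrightarrow> snd (a s) = b s"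
    by (rule conjunct1 [OF conjunct2 [OF bspec [OF h(2)]]])
  show "s \<in> {1..k} \<Longrightarrow> i \<in> {1..n} \<Longrightarrow> (x (i, b s) \<noteq> blank) \<longleftrightarrow> (i, b s) = a s"
    by (rule bspec [OF conjunct2 [OF conjunct2 [OF bspec [OF h(2)]]]])
  show "s \<in> {1..<k} \<Longrightarrow> ipoint (x (a s)) = Some (a (Suc s))"
    by (rule bspec [OF h(3)])
  show "s \<in> {1..k} \<Longrightarrow> t \<in> {1..k} \<Longrightarrow>
      lpoint (x (a s)) = lpoint (x (a t)) \<and> rpoint (x (a s)) = rpoint (x (a t))"
    by (rule bspec [OF bspec [OF h(5)]])
  show "j \<in> {1..m} - marked_cols n m x \<Longrightarrow> s \<in> {1..k} \<Longrightarrow>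
      \<exists>l. follow x (a s) (Tpath m j) = Some l \<and> snd l = j \<and> \<not> val (x l)"
    by (rule bspec [OF bspec [OF h(6)]])
qed

text \<open>Valid pointers never leave the grid, so no condition of \<open>h\<close> inspects a cell
  outside it. The bound \<open>1 \<le> k\<close> places \<open>a k\<close> among the special cells,
  on which the two functions agree.\<close>

lemma h_cong_imp:
  assumes "x \<in> inputs n m" "\<And>c. c \<in> grid n m \<Longrightarrow> y c = x c" "1 \<le> k" "h k n m x"
  shows "h k n m y"
proof -
  have "marked n y j = marked n x j" if "j \<in> {1..m}" for j
    unfolding marked_def using that by (intro ball_cong refl) (simp add: assms(2) grid_def)
  then have mc: "marked_cols n m y = marked_cols n m x"
    by (auto simp: marked_cols_def)
  obtain b a where "h_witness k n m x b a"
    using assms(4) unfolding h_iff_witness by blast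
  note h = h_witnessD [OF this]
  have ya: "y (a s) = x (a s)" if "s \<in> {1..k}" for s
    using assms(2) [OF h(2) [OF that]] .
  show ?thesis
  proof (rule hI)
    fix s i assume s: "s \<in> {1..k}" and i: "i \<in> {1..n}"
    have "(i, b s) \<in> grid n m"
      using h(2,3) [OF s] i by (cases "a s") (simp add: grid_def)
    then show "(y (i, b s) \<noteq> blank) \<longleftrightarrow> (i, b s) = a s"
      using h(4) [OF s i] assms(2) by simp
  next
    fix j s assume js: "j \<in> {1..m} - marked_cols n m y" "s \<in> {1..k}"
    obtain l where l: "follow x (a s) (Tpath m j) = Some l" "snd l = j" "\<not> val (x l)"
      using h(8) [OF js [unfolded mc]] by blast
    note as = h(2) [OF js(2)]
    have "l \<in> grid n m" by (rule follow_in_grid [OF assms(1) as l(1)])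
    then show "\<exists>l. follow y (a s) (Tpath m j) = Some l \<and> snd l = j \<and> \<not> val (y l)"
      using l follow_cong [OF assms(1,2) as] assms(2) by simp
  next
    show "bij_betw b {1..k} (marked_cols n m y)" using h(1) by (simp only: mc)
    show "ipoint (y (a k)) = Some (a 1)" using h(6) assms(3) by (simp add: ya)
    show "ipoint (y (a s)) = Some (a (Suc s))" if "s \<in> {1..<k}" for s
      using h(5) [OF that] that by (simp add: ya)
    show "lpoint (y (a s)) = lpoint (y (a t)) \<and> rpoint (y (a s)) = rpoint (y (a t))"
      if "s \<in> {1..k}" "t \<in> {1..k}" for s t
      unfolding ya [OF that(1)] ya [OF that(2)] by (rule h(7) [OF that])
  qed (rule h(2,3); assumption)+
qed

lemma h_canon:
  assumes "x \<in> inputs n m" "1 \<le> k"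
  shows "h k n m (canon n m x) = h k n m x"
proof
  have "canon n m x \<in> inputs n m"
    using canon_in_canon_inputs [OF assms(1)] canon_inputs_subset by blast
  then show "h k n m (canon n m x) \<Longrightarrow> h k n m x"
    by (rule h_cong_imp) (use assms in \<open>simp_all add: canon_def\<close>)
  show "h k n m x \<Longrightarrow> h k n m (canon n m x)"
    by (rule h_cong_imp [OF assms(1)]) (use assms in \<open>simp_all add: canon_def\<close>)
qed

section \<open>The verifier: following internal pointers from a candidate cell\<close>

fun trace :: "nat \<Rightarrow> cell \<Rightarrow> input \<Rightarrow> (cell \<times> sym) list" where
  "trace 0 c x = []"
| "trace (Suc r) c x = (c, x c) # (case ipoint (x c) of None \<Rightarrow> [] | Some c' \<Rightarrow> trace r c' x)"

lemma length_trace: "length (trace r c x) \<le> r"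
  by (induction r arbitrary: c) (auto split: option.split)

lemma trace_eq_map: "trace r c x = map (\<lambda>a. (a, x a)) (map fst (trace r c x))"
  by (induction r arbitrary: c) (auto split: option.split)

lemma trace_in_grid:
  assumes "x \<in> inputs n m" "c \<in> grid n m"
  shows "fst ` set (trace r c x) \<subseteq> grid n m"
  using assms(2)
proof (induction r arbitrary: c)
  case (Suc r)
  show ?case
  proof (cases "ipoint (x c)")
    case None
    then show ?thesis using Suc.prems by simp
  next
    case (Some c')
    then have "c' \<in> grid n m" by (rule pointers_in_grid(3) [OF assms(1) Suc.prems])
    then show ?thesis using Suc.IH [of c'] Suc.prems Some by simp
  qed
qed simp

lemma trace_full:
  assumes "length (trace r c x) = r"
  shows "(0 < r \<longrightarrow> fst (trace r c x ! 0) = c) \<and>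
    (\<forall>i. Suc i < r \<longrightarrow> ipoint (x (fst (trace r c x ! i))) = Some (fst (trace r c x ! Suc i)))"
  using assms
proof (induction r arbitrary: c)
  case (Suc r)
  show ?case
  proof (cases "ipoint (x c)")
    case None
    then show ?thesis using Suc.prems by simp
  next
    case (Some c')
    then have IH: "(0 < r \<longrightarrow> fst (trace r c' x ! 0) = c') \<and>
      (\<forall>i. Suc i < r \<longrightarrow> ipoint (x (fst (trace r c' x ! i))) = Some (fst (trace r c' x ! Suc i)))"
      using Suc by simp
    have "ipoint (x (fst (trace (Suc r) c x ! i))) = Some (fst (trace (Suc r) c x ! Suc i))"
      if "Suc i < Suc r" for i
      using that IH Some by (cases i) auto
    then show ?thesis by simp
  qed
qed simp

lemma trace_eqI:
  assumes "length as = r" "0 < r \<Longrightarrow> as ! 0 = c"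
    "\<And>i. Suc i < r \<Longrightarrow> ipoint (x (as ! i)) = Some (as ! Suc i)"
  shows "trace r c x = map (\<lambda>a. (a, x a)) as"
  using assms
proof (induction r arbitrary: c as)
  case (Suc r)
  then obtain as' where as: "as = c # as'" "length as' = r"
    by (cases as) auto
  show ?case
  proof (cases r)
    case 0
    then show ?thesis using as by (simp split: option.split)
  next
    case (Suc r')
    then have "ipoint (x c) = Some (as' ! 0)"
      using Suc.prems(3) [of 0] as by simp
    moreover have "trace r (as' ! 0) x = map (\<lambda>a. (a, x a)) as'"
      using as Suc.prems(3) [of "Suc _"] by (intro Suc.IH) auto
    ultimately show ?thesis using as by simp
  qed
qed simp

definition trace_cols :: "(cell \<times> sym) list \<Rightarrow> nat set" where
  "trace_cols tr = (\<lambda>q. snd (fst q)) ` set tr"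

definition ends_at_zero :: "nat \<Rightarrow> cell \<Rightarrow> bool list \<Rightarrow> input \<Rightarrow> bool" where
  "ends_at_zero j c ds x \<longleftrightarrow> (\<exists>l. follow x c ds = Some l \<and> snd l = j \<and> \<not> val (x l))"

text \<open>Collects the conditions that the trace alone decides, hence without further queries;
  this is why a trace stores symbols along with cells. The symbol of the last cell contains the
  pointer that must close the cycle.\<close>

definition trace_ok :: "nat \<Rightarrow> cell \<Rightarrow> (cell \<times> sym) list \<Rightarrow> bool" where
  "trace_ok k c tr \<longleftrightarrow> length tr = k \<and> distinct (map (\<lambda>q. snd (fst q)) tr) \<and>
     ipoint (snd (last tr)) = Some c \<and>
     (\<forall>q\<in>set tr. snd q \<noteq> blank \<and> lpoint (snd q) = lpoint (snd (hd tr)) \<and> rpoint (snd q) = rpoint (snd (hd tr)))"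

definition cells_ok :: "nat \<Rightarrow> (cell \<times> sym) list \<Rightarrow> input \<Rightarrow> bool" where
  "cells_ok n tr x \<longleftrightarrow> (\<forall>c\<in>{1..n} \<times> trace_cols tr. val (x c) \<and> (c \<notin> fst ` set tr \<longrightarrow> x c = blank))"

definition cols_ok :: "nat \<Rightarrow> cell \<Rightarrow> (cell \<times> sym) list \<Rightarrow> input \<Rightarrow> bool" where
  "cols_ok m c tr x \<longleftrightarrow> (\<forall>j\<in>{1..m} - trace_cols tr. ends_at_zero j c (Tpath m j) x)"

definition verifies :: "nat \<Rightarrow> nat \<Rightarrow> nat \<Rightarrow> cell \<Rightarrow> input \<Rightarrow> bool" where
  "verifies k n m c x \<longleftrightarrow>
     (let tr = trace k c x in trace_ok k c tr \<and> cells_ok n tr x \<and> cols_ok m c tr x)"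

text \<open>Soundness for every grid cell \<open>c\<close>, however it was found. The trace supplies
  \<open>k\<close> distinct full columns, and the tree paths certify that there are no
  others.\<close>

lemma verifies_imp_h:
  assumes "x \<in> inputs n m" "c \<in> grid n m" "1 \<le> k" "verifies k n m c x"
  shows "h k n m x"
proof -
  define as where "as = map fst (trace k c x)"
  have tr: "trace k c x = map (\<lambda>a. (a, x a)) as"
    unfolding as_def by (rule trace_eq_map)
  have ok: "trace_ok k c (trace k c x)" "cells_ok n (trace k c x) x" "cols_ok m c (trace k c x) x"
    using assms(4) by (auto simp: verifies_def Let_def)
  have len: "length as = k" using ok(1) by (simp add: trace_ok_def as_def)
  have ne: "as \<noteq> []" using len assms(3) by auto
  have cols: "trace_cols (trace k c x) = snd ` set as"
    unfolding tr by (simp add: trace_cols_def image_image)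
  have dist: "distinct (map snd as)"
    using ok(1) unfolding tr by (simp add: trace_ok_def o_def)
  have full: "as ! 0 = c" "\<And>i. Suc i < k \<Longrightarrow> ipoint (x (as ! i)) = Some (as ! Suc i)"
    using trace_full [of k c x] len assms(3) by (auto simp: as_def)
  have last: "ipoint (x (as ! (k - 1))) = Some c"
    using ok(1) ne len assms(3) unfolding tr by (simp add: trace_ok_def last_conv_nth [of as] last_map)
  have sp: "x a \<noteq> blank" "lpoint (x a) = lpoint (x c)" "rpoint (x a) = rpoint (x c)" if "a \<in> set as" for a
    using ok(1) that ne full(1) unfolding tr by (auto simp: trace_ok_def hd_map hd_conv_nth)
  have grid: "set as \<subseteq> grid n m"
    using trace_in_grid [OF assms(1,2), of k] by (simp add: as_def)
  have cells: "val (x (i, j))" "(i, j) \<notin> set as \<Longrightarrow> x (i, j) = blank"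
    if "i \<in> {1..n}" "j \<in> snd ` set as" for i j
    using ok(2) that unfolding cells_ok_def cols by (force simp: as_def)+
  have zero: "ends_at_zero j c (Tpath m j) x" if "j \<in> {1..m} - snd ` set as" for j
    using ok(3) that unfolding cols_ok_def cols by blast
  \<comment> \<open>Columns of the trace consist of ones by \<open>cells_ok\<close>; any other
    column contains the zero at the end of its tree path.\<close>
  have marked: "marked_cols n m x = snd ` set as"
  proof
    show "snd ` set as \<subseteq> marked_cols n m x"
    proof
      fix j assume j: "j \<in> snd ` set as"
      then have "j \<in> {1..m}" using grid by (auto simp: grid_def)
      then show "j \<in> marked_cols n m x"
        using cells(1) [OF _ j] by (simp add: marked_cols_def marked_def)
    qed
    show "marked_cols n m x \<subseteq> snd ` set as"
    proof
      fix j assume j: "j \<in> marked_cols n m x"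
      show "j \<in> snd ` set as"
      proof (rule ccontr)
        assume "j \<notin> snd ` set as"
        then obtain l where l: "follow x c (Tpath m j) = Some l" "snd l = j" "\<not> val (x l)"
          using zero [of j] j by (auto simp: marked_cols_def ends_at_zero_def)
        have "l \<in> grid n m" by (rule follow_in_grid [OF assms(1,2) l(1)])
        then show False
          using j l by (cases l) (auto simp: marked_cols_def marked_def grid_def)
      qed
    qed
  qed
  define a where "a s = as ! (s - 1)" for s
  define b where "b s = snd (a s)" for s
  have a_mem: "a s \<in> set as" if "s \<in> {1..k}" for s
    unfolding a_def using that len by (intro nth_mem) auto
  have a_img: "a ` {1..k} = set as"
  proof
    show "a ` {1..k} \<subseteq> set as" using a_mem by blast
    show "set as \<subseteq> a ` {1..k}"
    proof
      fix c' assume "c' \<in> set as"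
      then obtain i where "i < k" "c' = as ! i" using len by (auto simp: in_set_conv_nth)
      then show "c' \<in> a ` {1..k}" by (intro image_eqI [of _ _ "Suc i"]) (auto simp: a_def)
    qed
  qed
  have b_inj: "s = t" if "b s = b t" "s \<in> {1..k}" "t \<in> {1..k}" for s t
  proof -
    have lt: "s - 1 < length as" "t - 1 < length as"
      using that len by auto
    have "map snd as ! (s - 1) = map snd as ! (t - 1)"
      using that(1) by (simp only: nth_map [OF lt(1)] nth_map [OF lt(2)] b_def a_def)
    then have "s - 1 = t - 1"
      using nth_eq_iff_index_eq [OF dist] lt by (simp only: length_map)
    then show ?thesis using that by auto
  qed
  have "b ` {1..k} = snd ` set as"
    unfolding a_img [symmetric] by (auto simp: b_def image_image)
  then have bij: "bij_betw b {1..k} (marked_cols n m x)"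
    unfolding marked using b_inj by (auto simp: bij_betw_def inj_on_def)
  show ?thesis
  proof (rule hI [OF bij])
    fix s assume s: "s \<in> {1..k}"
    show "a s \<in> grid n m" "snd (a s) = b s"
      using a_mem [OF s] grid by (auto simp: b_def)
    fix i assume i: "i \<in> {1..n}"
    show "(x (i, b s) \<noteq> blank) \<longleftrightarrow> (i, b s) = a s"
    proof
      assume "x (i, b s) \<noteq> blank"
      moreover have "b s \<in> snd ` set as"
        unfolding b_def using a_mem [OF s] by (rule imageI)
      ultimately have "(i, b s) \<in> a ` {1..k}"
        using cells(2) [OF i] unfolding a_img by blast
      then obtain t where t: "t \<in> {1..k}" "(i, b s) = a t" by blast
      then have "b t = b s" unfolding b_def [of t] by (metis snd_conv)
      then have "t = s" using b_inj t(1) s by blast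
      then show "(i, b s) = a s" using t(2) by (simp only:)
    next
      assume "(i, b s) = a s"
      then show "x (i, b s) \<noteq> blank" using sp(1) [OF a_mem [OF s]] by (simp only: not_False_eq_True)
    qed
  next
    show "ipoint (x (a s)) = Some (a (Suc s))" if "s \<in> {1..<k}" for s
    proof -
      have "Suc (s - 1) = s" "s < k" using that by auto
      then show ?thesis using full(2) [of "s - 1"] by (simp add: a_def)
    qed
    show "ipoint (x (a k)) = Some (a 1)"
      using last full(1) by (simp add: a_def)
    show "lpoint (x (a s)) = lpoint (x (a t)) \<and> rpoint (x (a s)) = rpoint (x (a t))"
      if "s \<in> {1..k}" "t \<in> {1..k}" for s t
      using sp(2,3) [OF a_mem [OF that(1)]] sp(2,3) [OF a_mem [OF that(2)]] by (simp only:)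
  next
    fix j s assume j: "j \<in> {1..m} - marked_cols n m x" and s: "s \<in> {1..k}"
    have j': "j \<in> {1..m} - snd ` set as" using j unfolding marked .
    have c: "c \<in> set as" using full(1) ne by (metis length_greater_0_conv nth_mem)
    obtain l where l: "follow x c (Tpath m j) = Some l" "snd l = j" "\<not> val (x l)"
      using zero [OF j'] unfolding ends_at_zero_def by blast
    \<comment> \<open>All special cells share their tree pointers, so only an empty path could tell
      them apart. It would end at \<open>c\<close> itself, whose column is marked, contrary to the
      choice of \<open>j\<close>.\<close>
    have "follow x (a s) (Tpath m j) = follow x c (Tpath m j)"
    proof (cases "Tpath m j")
      case Nil
      then have "snd c = j" using l by simp
      then show ?thesis using j' c by blast
    next
      case (Cons d ds)
      then show ?thesis using sp(2,3) [OF a_mem [OF s]] by simp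
    qed
    then show "\<exists>l. follow x (a s) (Tpath m j) = Some l \<and> snd l = j \<and> \<not> val (x l)"
      using l by simp
  qed
qed

text \<open>Completeness for every special cell, not only for \<open>a 1\<close>: the conditions are
  invariant under rotation of the cycle, so whichever special cell the search returns passes the
  check.\<close>

lemma h_imp_verifies:
  assumes "1 \<le> k" "h k n m x" "j \<in> marked_cols n m x" "i \<in> {1..n}" "x (i, j) \<noteq> blank"
  shows "verifies k n m (i, j) x"
proof -
  obtain b a where "h_witness k n m x b a"
    using assms(2) unfolding h_iff_witness by blast
  note h = h_witnessD [OF this]
  note bij = h(1) and a1 = h(2,3) and a = h(4) and next1 = h(5,6) and lr = h(7) and path = h(8)
  have "j \<in> b ` {1..k}"
    unfolding bij_betw_imp_surj_on [OF bij] by (rule assms(3))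
  then obtain s where s: "s \<in> {1..k}" "b s = j"
    by (elim imageE) simp
  have as: "a s = (i, j)"
    by (rule sym [OF iffD1 [OF a [OF s(1) assms(4), unfolded s(2)] assms(5)]])
  \<comment> \<open>The enumeration rotated to begin at \<open>s\<close>; the shift is
    \<open>s - 1\<close> and 1 is added at the end because the cycle is numbered from 1.\<close>
  define idx where "idx i = (i + (s - 1)) mod k + 1" for i
  have idx_mem: "idx i \<in> {1..k}" for i
  proof -
    have "(i + (s - 1)) mod k < k" using assms(1) by simp
    then show ?thesis by (simp add: idx_def Suc_le_eq)
  qed
  have idx_inj: "inj_on idx {0..<k}"
  proof (rule inj_onI)
    fix i i' assume ii: "i \<in> {0..<k}" "i' \<in> {0..<k}" "idx i = idx i'"
    have key: "i = ((i + (s - 1)) mod k + (k - (s - 1))) mod k" if "i \<in> {0..<k}" for i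
    proof -
      have "i < k" "s - 1 < k" "(i + (s - 1)) mod k < k" using that s(1) assms(1) by auto
      from mod_shift_iff [OF this(3,1,2)] show ?thesis by simp
    qed
    have eq: "(i + (s - 1)) mod k = (i' + (s - 1)) mod k"
      using ii(3) by (simp only: idx_def add_right_cancel)
    show "i = i'"
      by (rule trans [OF key [OF ii(1)]]) (simp only: eq key [OF ii(2), symmetric])
  qed
  have idx_img: "idx ` {0..<k} = {1..k}"
  proof (rule card_subset_eq)
    show "idx ` {0..<k} \<subseteq> {1..k}" using idx_mem by blast
    show "card (idx ` {0..<k}) = card {1..k}" unfolding card_image [OF idx_inj] by simp
  qed simp
  have idx_0: "idx 0 = s" "idx k = s"
  proof -
    obtain s' where s': "s = Suc s'" "s' < k" using s(1) by (cases s) auto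
    then show "idx 0 = s" "idx k = s" by (simp_all add: idx_def)
  qed
  have next_idx: "ipoint (x (a (idx i))) = Some (a (idx (Suc i)))" for i
  proof (cases "idx i = k")
    case True
    then have "Suc ((i + (s - 1)) mod k) = k" by (simp add: idx_def)
    then have "idx (Suc i) = 1" by (simp add: idx_def mod_Suc)
    then show ?thesis using next1(2) True by simp
  next
    case False
    then have "Suc ((i + (s - 1)) mod k) \<noteq> k" by (simp add: idx_def)
    then have "idx (Suc i) = Suc (idx i)" by (simp add: idx_def mod_Suc)
    then show ?thesis using next1(1) [of "idx i"] False idx_mem [of i] by auto
  qed
  define cs where "cs = map (\<lambda>i. a (idx i)) [0..<k]"
  have cs_set: "set cs = a ` {1..k}"
    unfolding cs_def idx_img [symmetric] by (simp add: image_image)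
  have len: "length cs = k" by (simp add: cs_def)
  have cs0: "cs ! 0 = (i, j)" using assms(1) idx_0 as by (simp add: cs_def)
  have ne: "cs \<noteq> []" using len assms(1) by auto
  have tr: "trace k (i, j) x = map (\<lambda>a. (a, x a)) cs"
    by (rule trace_eqI) (use len cs0 next_idx in \<open>auto simp: cs_def\<close>)
  have cols: "trace_cols (trace k (i, j) x) = marked_cols n m x"
  proof -
    have "trace_cols (trace k (i, j) x) = snd ` a ` {1..k}"
      unfolding tr cs_set [symmetric] by (simp add: trace_cols_def image_image)
    also have "\<dots> = b ` {1..k}"
      unfolding image_image using a1(2) by (intro image_cong) auto
    also have "\<dots> = marked_cols n m x"
      using bij by (simp add: bij_betw_def)
    finally show ?thesis .
  qed
  have "trace_ok k (i, j) (trace k (i, j) x)"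
    unfolding trace_ok_def
  proof (intro conjI ballI)
    show "length (trace k (i, j) x) = k" by (simp add: tr len)
    have "map (\<lambda>q. snd (fst q)) (trace k (i, j) x) = map (\<lambda>i. b (idx i)) [0..<k]"
      unfolding tr cs_def using a1(2) idx_mem by simp
    moreover have "distinct (map (\<lambda>i. b (idx i)) [0..<k])"
      using bij idx_inj idx_img comp_inj_on [of idx "{0..<k}" b]
      by (simp add: distinct_map bij_betw_def o_def)
    ultimately show "distinct (map (\<lambda>q. snd (fst q)) (trace k (i, j) x))" by simp
    have "last (trace k (i, j) x) = (a (idx (k - 1)), x (a (idx (k - 1))))"
      unfolding tr using ne assms(1) by (simp add: last_map last_conv_nth len) (simp add: cs_def)
    then show "ipoint (snd (last (trace k (i, j) x))) = Some (i, j)"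
      using next_idx [of "k - 1"] assms(1) idx_0 as by simp
    fix q assume "q \<in> set (trace k (i, j) x)"
    then obtain t where t: "t \<in> {1..k}" "q = (a t, x (a t))"
      unfolding tr by (auto simp: cs_set)
    have hd: "snd (hd (trace k (i, j) x)) = x (a s)"
      unfolding tr using ne cs0 as by (simp add: hd_map hd_conv_nth)
    show "lpoint (snd q) = lpoint (snd (hd (trace k (i, j) x)))"
      "rpoint (snd q) = rpoint (snd (hd (trace k (i, j) x)))"
      unfolding hd using lr [OF t(1) s(1)] t(2) by simp_all
    have "fst (a t) \<in> {1..n}" and eq: "(fst (a t), b t) = a t"
      using a1 [OF t(1)] by (auto simp: grid_def prod_eq_iff)
    then have "x (a t) \<noteq> blank"
      using a [OF t(1), of "fst (a t)"] by (simp only: eq)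
    then show "snd q \<noteq> blank" using t(2) by simp
  qed
  moreover have "cells_ok n (trace k (i, j) x) x"
    unfolding cells_ok_def cols
  proof (intro ballI conjI impI)
    fix c assume c: "c \<in> {1..n} \<times> marked_cols n m x"
    then show "val (x c)" by (auto simp: marked_cols_def marked_def)
    assume nin: "c \<notin> fst ` set (trace k (i, j) x)"
    have "snd c \<in> b ` {1..k}"
      unfolding bij_betw_imp_surj_on [OF bij] using c by auto
    then obtain t where t: "t \<in> {1..k}" "snd c = b t"
      by blast
    have "c \<noteq> a t" using nin t unfolding tr by (auto simp: image_image cs_set)
    then show "x c = blank"
      using a [OF t(1), of "fst c"] c t(2) by (cases c) auto
  qed
  moreover have "cols_ok m (i, j) (trace k (i, j) x) x"
    unfolding cols_ok_def cols unfolding ends_at_zero_def as [symmetric] by (intro ballI path s(1))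
  ultimately show ?thesis by (simp add: verifies_def Let_def)
qed

section \<open>Query kernels for the check\<close>

lemma distinguishable_trace:
  assumes "c \<in> grid n m"
  shows "canon.distinguishable n m (trace r c) (real r)"
  using assms
proof (induction r arbitrary: c)
  case 0
  then show ?case by (simp add: canon.distinguishable_const)
next
  case (Suc r)
  have "canon.distinguishable n m (trace (Suc r) c) (1 + real r)"
  proof (rule canon.distinguishable_bind)
    show "canon.distinguishable n m (\<lambda>x. x c) 1"
      by (rule canon.distinguishable_query [OF Suc.prems])
    show "trace (Suc r) c x = trace (Suc r) c y \<longleftrightarrow> x c = y c \<and>
        (case ipoint (x c) of None \<Rightarrow> [] | Some c' \<Rightarrow> trace r c' x) =
        (case ipoint (x c) of None \<Rightarrow> [] | Some c' \<Rightarrow> trace r c' y)" for x y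
      by (cases "x c = y c") simp_all
    fix s assume "s \<in> (\<lambda>x. x c) ` canon_inputs n m"
    then obtain x where x: "x \<in> inputs n m" "s = x c"
      using canon_inputs_subset by blast
    show "canon.distinguishable n m (\<lambda>x. case ipoint s of None \<Rightarrow> [] | Some c' \<Rightarrow> trace r c' x) (real r)"
    proof (cases "ipoint s")
      case None
      then show ?thesis by (simp add: canon.distinguishable_const)
    next
      case (Some c')
      then have "c' \<in> grid n m"
        using pointers_in_grid(3) [OF x(1) Suc.prems] x(2) by simp
      then show ?thesis using Suc.IH Some by simp
    qed
  qed
  then show ?case by (simp only: of_nat_Suc)
qed

lemma distinguishable_ends_at_zero:
  assumes "c \<in> grid n m"
  shows "canon.distinguishable n m (ends_at_zero j c ds) (real (length ds) + 1)"
  using assms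
proof (induction ds arbitrary: c)
  case Nil
  have "canon.distinguishable n m (ends_at_zero j c []) 1"
    by (rule canon.distinguishable_bool [OF canon.distinguishable_query [OF Nil]]) (simp add: ends_at_zero_def)
  then show ?case by simp
next
  case (Cons d ds)
  define F where "F s x = (case (if d then rpoint s else lpoint s) of
      None \<Rightarrow> False | Some c' \<Rightarrow> ends_at_zero j c' ds x)" for s x
  have "canon.distinguishable n m (\<lambda>x. F (x c) x) (1 + (real (length ds) + 1))"
  proof (rule canon.distinguishable_bind_bool [where F = F, OF canon.distinguishable_query [OF Cons.prems]])
    fix s assume "s \<in> (\<lambda>x. x c) ` canon_inputs n m"
    then obtain x where x: "x \<in> inputs n m" "s = x c"
      using canon_inputs_subset by blast
    show "canon.distinguishable n m (F s) (real (length ds) + 1)"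
    proof (cases "if d then rpoint s else lpoint s")
      case None
      then have "F s = (\<lambda>x. False)" by (simp add: F_def fun_eq_iff)
      then show ?thesis by (simp add: canon.distinguishable_const)
    next
      case (Some c')
      then have "c' \<in> grid n m"
        using pointers_in_grid(1,2) [OF x(1) Cons.prems] x(2) by (cases d) simp_all
      moreover have "F s = ends_at_zero j c' ds"
        using Some by (simp add: F_def fun_eq_iff)
      ultimately show ?thesis using Cons.IH by simp
    qed
  qed
  moreover have "(\<lambda>x. F (x c) x) = ends_at_zero j c (d # ds)"
    by (auto simp: F_def fun_eq_iff ends_at_zero_def split: option.split)
  ultimately show ?case by (simp add: add.commute)
qed

lemma distinguishable_cells_ok:
  assumes "trace_cols tr \<subseteq> {1..m}"
  shows "canon.distinguishable n m (cells_ok n tr) (sqrt (real n * real (length tr)))"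
proof (rule canon.distinguishable_mono)
  let ?J = "{1..n} \<times> trace_cols tr"
  have fin: "finite (trace_cols tr)"
    by (simp add: trace_cols_def)
  have "canon.distinguishable n m (cells_ok n tr) (sqrt (card ?J) * 1)"
    unfolding cells_ok_def
  proof (rule canon.distinguishable_all)
    fix c assume "c \<in> ?J"
    then have "c \<in> grid n m" using assms by (auto simp: grid_def)
    then show "canon.distinguishable n m (\<lambda>x. val (x c) \<and> (c \<notin> fst ` set tr \<longrightarrow> x c = blank)) 1"
      by (rule canon.distinguishable_bool [OF canon.distinguishable_query]) (simp only:)
  qed (use fin in simp_all)
  then show "canon.distinguishable n m (cells_ok n tr) (sqrt (card ?J))" by simp
  have "card (trace_cols tr) \<le> length tr"
    unfolding trace_cols_def using card_image_le card_length le_trans by blast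
  then show "sqrt (card ?J) \<le> sqrt (real n * real (length tr))"
    by (simp add: card_cartesian_product mult_left_mono)
qed

text \<open>A tree path has at most \<open>floor_log m + 1\<close> arcs, and one more query reads
  the value at its end. This is the only source of a logarithm in the final bound.\<close>

lemma distinguishable_cols_ok:
  assumes "c \<in> grid n m"
  shows "canon.distinguishable n m (cols_ok m c tr) (sqrt m * (floor_log m + 2))"
proof (rule canon.distinguishable_mono)
  let ?J = "{1..m} - trace_cols tr"
  show "canon.distinguishable n m (cols_ok m c tr) (sqrt (card ?J) * (floor_log m + 2))"
    unfolding cols_ok_def
  proof (rule canon.distinguishable_all)
    fix j assume "j \<in> ?J"
    then have "length (Tpath m j) \<le> floor_log m + 1" by (intro length_Tpath) auto
    then show "canon.distinguishable n m (ends_at_zero j c (Tpath m j)) (floor_log m + 2)"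
      by (intro canon.distinguishable_mono [OF distinguishable_ends_at_zero [OF assms]]) simp
  qed simp_all
  have "card ?J \<le> m"
    using card_mono [of "{1..m}" ?J] by simp
  then show "sqrt (card ?J) * (floor_log m + 2) \<le> sqrt m * (floor_log m + 2)"
    by (intro mult_right_mono) simp_all
qed

lemma distinguishable_verifies:
  assumes "c \<in> grid n m"
  shows "canon.distinguishable n m (verifies k n m c) (real k + (sqrt (real n * real k) + sqrt m * (floor_log m + 2)))"
proof -
  define F where "F tr x \<longleftrightarrow> trace_ok k c tr \<and> cells_ok n tr x \<and> cols_ok m c tr x" for tr x
  have "canon.distinguishable n m (\<lambda>x. F (trace k c x) x) (real k + (sqrt (real n * real k) + sqrt m * (floor_log m + 2)))"
  proof (rule canon.distinguishable_bind_bool [where F = F, OF distinguishable_trace [OF assms]])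
    fix tr assume "tr \<in> trace k c ` canon_inputs n m"
    then obtain x where x: "x \<in> inputs n m" "tr = trace k c x"
      using canon_inputs_subset by blast
    have "fst ` set tr \<subseteq> grid n m"
      unfolding x(2) by (rule trace_in_grid [OF x(1) assms])
    then have cols: "trace_cols tr \<subseteq> {1..m}"
      by (auto simp: trace_cols_def grid_def)
    have len: "length tr \<le> k" unfolding x(2) by (rule length_trace)
    have nn: "0 \<le> sqrt (real m) * real (floor_log m + 2)" by simp
    have "canon.distinguishable n m (\<lambda>x. cells_ok n tr x \<and> cols_ok m c tr x)
        (sqrt (real n * real (length tr)) + sqrt m * (floor_log m + 2))"
      by (rule canon.distinguishable_conj [OF distinguishable_cells_ok [OF cols] distinguishable_cols_ok [OF assms] nn])
    then have base: "canon.distinguishable n m (\<lambda>x. cells_ok n tr x \<and> cols_ok m c tr x)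
        (sqrt (real n * real k) + sqrt m * (floor_log m + 2))"
      by (rule canon.distinguishable_mono) (use len in \<open>simp add: mult_left_mono\<close>)
    show "canon.distinguishable n m (F tr) (sqrt (real n * real k) + sqrt m * (floor_log m + 2))"
    proof (cases "trace_ok k c tr")
      case True
      then have "F tr = (\<lambda>x. cells_ok n tr x \<and> cols_ok m c tr x)"
        by (simp add: F_def fun_eq_iff)
      then show ?thesis using base by (simp only:)
    next
      case False
      then have "F tr = (\<lambda>x. False)" by (simp add: F_def fun_eq_iff)
      then show ?thesis using nn by (simp only:) (simp add: canon.distinguishable_const)
    qed
  qed
  moreover have "(\<lambda>x. F (trace k c x) x) = verifies k n m c"
    by (simp add: F_def verifies_def Let_def fun_eq_iff)
  ultimately show ?thesis by simp
qed

text \<open>The target state superposes the cells that a search for a marked column, followed by a search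
  for a special cell inside it, produces; each cell is tagged with the outcome of its verification.
  On a positive input both searches are calibrated exactly, so that the whole state is tagged as
  verified; on a negative input no part of it is.\<close>
theorem computes_with_h:
  assumes n: "1 \<le> n" and k: "1 \<le> k" "k < m" and K: "1 \<le> K"
    "40 * (2 * sqrt (real m / real k) * sqrt (real n) + 2 * sqrt (real n)
       + (real k + (sqrt (real n * real k) + sqrt m * (floor_log m + 2)))) \<le> real K"
  shows "computes_with n m (h k n m) K"
proof -
  define LV where "LV = real k + (sqrt (real n * real k) + sqrt m * (floor_log m + 2))"
  define t where "t x = real (card {j \<in> {1..m}. marked n x j})" for x :: input
  define t' where "t' j x = real (card {i \<in> {1..n}. x (i, j) \<noteq> blank})" for j :: nat and x :: input
  define s where "s j x = of_bool (marked n x j) * found_amp k (t x)" for j :: nat and x :: input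
  \<comment> \<open>The inner search is calibrated for one item: a marked column of a positive input
    has exactly one non-blank cell.\<close>
  define s' where "s' j i x = of_bool (x (i, j) \<noteq> blank) * found_amp 1 (t' j x)" for j i :: nat and x :: input
  define f where "f x = fail_amp k (t x)" for x :: input
  define f' where "f' j x = fail_amp 1 (t' j x)" for j :: nat and x :: input
  define V where "V j i x \<longleftrightarrow> verifies k n m (i, j) x" for j i :: nat and x :: input
  let ?J = "{1..m}" and ?I = "{1..n}"
  define A where "A x y = (\<Sum>j\<in>?J. \<Sum>i\<in>?I. (s j x * s' j i x * of_bool (V j i x)) * (s j y * s' j i y * of_bool (V j i y)))" for x y :: input
  \<comment> \<open>Three ways to reject: no column found, a column but no special cell found, a
    cell found that fails the verification.\<close>
  define A' where "A' x y = f x * f y + (\<Sum>j\<in>?J. (s j x * f' j x) * (s j y * f' j y))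
      + (\<Sum>j\<in>?J. \<Sum>i\<in>?I. (s j x * s' j i x * of_bool (\<not> V j i x)) * (s j y * s' j i y * of_bool (\<not> V j i y)))" for x y :: input
  have m: "1 \<le> m" using k by simp
  have kpos: "0 < real k" using k by simp
  have distinguishable_marked: "canon.distinguishable n m (\<lambda>x. marked n x j) (sqrt n)" if "j \<in> ?J" for j
  proof -
    have "canon.distinguishable n m (\<lambda>x. \<forall>i\<in>?I. val (x (i, j))) (sqrt (card ?I) * 1)"
    proof (rule canon.distinguishable_all)
      fix i assume "i \<in> ?I"
      then have "(i, j) \<in> grid n m" using that by (simp add: grid_def)
      then show "canon.distinguishable n m (\<lambda>x. val (x (i, j))) 1"
        by (rule canon.distinguishable_bool [OF canon.distinguishable_query]) (simp only:)
    qed simp_all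
    then show ?thesis by (simp add: marked_def)
  qed
  have distinguishable_special: "canon.distinguishable n m (\<lambda>x. x (i, j) \<noteq> blank) 1" if "j \<in> ?J" "i \<in> ?I" for i j
  proof -
    have "(i, j) \<in> grid n m" using that by (simp add: grid_def)
    then show ?thesis
      by (rule canon.distinguishable_bool [OF canon.distinguishable_query]) (simp only:)
  qed
  have distinguishable_V: "canon.distinguishable n m (V j i) LV" if "j \<in> ?J" "i \<in> ?I" for i j
    unfolding V_def LV_def using that by (intro distinguishable_verifies) (simp add: grid_def)
  have E1: "canon.qker n m (\<lambda>x y. 1 - f x * f y - (\<Sum>j\<in>?J. s j x * s j y)) (\<lambda>_. 2 * sqrt (real m / real k) * sqrt (real n))"
    using canon.qker_search [where J = ?J and z = "\<lambda>j x. marked n x j" and k = "real k", OF _ _ distinguishable_marked] m kpos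
    unfolding f_def s_def t_def by simp
  have E2: "canon.qker n m (\<lambda>x y. 1 - f' j x * f' j y - (\<Sum>i\<in>?I. s' j i x * s' j i y)) (\<lambda>_. 2 * sqrt (real n))"
    if "j \<in> ?J" for j
    using canon.qker_search [where J = ?I and z = "\<lambda>i x. x (i, j) \<noteq> blank" and k = 1, OF _ _ distinguishable_special [OF that]] n
    unfolding f'_def s'_def t'_def by simp
  have s_le: "(\<Sum>j\<in>?J. s j x * s j x) \<le> 1" for x
    unfolding s_def t_def by (rule found_amp_sum_le_1) (use kpos in simp_all)
  have s'_le: "(\<Sum>i\<in>?I. s' j i x * s' j i x) \<le> 1" for j x
    unfolding s'_def t'_def by (rule found_amp_sum_le_1) simp_all
  have LV: "0 \<le> LV" by (simp add: LV_def)
  then have nonneg: "0 \<le> 2 * sqrt (real n) + LV" by simp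
  \<comment> \<open>A telescoping sum over the three phases: each later kernel is weighted by the
    Gram matrix of the branches that reach it.\<close>
  have "canon.qker n m
      (\<lambda>x y. (1 - f x * f y - (\<Sum>j\<in>?J. s j x * s j y)) +
         (\<Sum>j\<in>?J. (s j x * s j y) *
            ((1 - f' j x * f' j y - (\<Sum>i\<in>?I. s' j i x * s' j i y))
             + (\<Sum>i\<in>?I. (s' j i x * s' j i y) * of_bool (V j i x \<noteq> V j i y)))))
      (\<lambda>x. 2 * sqrt (real m / real k) * sqrt (real n) +
         (\<Sum>j\<in>?J. (s j x * s j x) * (2 * sqrt (real n) + (\<Sum>i\<in>?I. (s' j i x * s' j i x) * LV))))"
    by (intro canon.qker_add canon.qker_sum canon.qker_psd_mult psd_rank1 E1 E2
          distinguishable_V [unfolded canon.distinguishable_def]) simp_all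
  then have E: "canon.qker n m (\<lambda>x y. 1 - A x y - A' x y)
      (\<lambda>_. 2 * sqrt (real m / real k) * sqrt (real n) + 2 * sqrt (real n) + LV)"
  proof (rule canon.qker_cong_mono)
    fix x y
    have "(s j x * s j y) *
            ((1 - f' j x * f' j y - (\<Sum>i\<in>?I. s' j i x * s' j i y))
             + (\<Sum>i\<in>?I. (s' j i x * s' j i y) * of_bool (V j i x \<noteq> V j i y)))
       = s j x * s j y - (s j x * f' j x) * (s j y * f' j y)
         - (\<Sum>i\<in>?I. (s j x * s' j i x * of_bool (V j i x)) * (s j y * s' j i y * of_bool (V j i y)))
         - (\<Sum>i\<in>?I. (s j x * s' j i x * of_bool (\<not> V j i x)) * (s j y * s' j i y * of_bool (\<not> V j i y)))" for j
    proof -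
      \<comment> \<open>For bits, the indicator of inequality is 1 minus the products for "both
        true" and "both false"; these two products supply the verified and unverified parts of the
        target.\<close>
      have "(\<Sum>i\<in>?I. (s' j i x * s' j i y) * of_bool (V j i x \<noteq> V j i y))
          = (\<Sum>i\<in>?I. s' j i x * s' j i y - (s' j i x * of_bool (V j i x)) * (s' j i y * of_bool (V j i y))
              - (s' j i x * of_bool (\<not> V j i x)) * (s' j i y * of_bool (\<not> V j i y)))"
        by (intro sum.cong) auto
      then show ?thesis
        by (simp add: sum_subtractf right_diff_distrib distrib_left sum_distrib_left mult_ac)
    qed
    then show "1 - A x y - A' x y = (1 - f x * f y - (\<Sum>j\<in>?J. s j x * s j y)) +
         (\<Sum>j\<in>?J. (s j x * s j y) *
            ((1 - f' j x * f' j y - (\<Sum>i\<in>?I. s' j i x * s' j i y))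
             + (\<Sum>i\<in>?I. (s' j i x * s' j i y) * of_bool (V j i x \<noteq> V j i y))))"
      by (simp only: A_def A'_def sum_subtractf)
  next
    fix x
    \<comment> \<open>Later phases are averaged over squared amplitudes of total at most 1, so their
      costs enter only once.\<close>
    have "(\<Sum>j\<in>?J. (s j x * s j x) * (2 * sqrt (real n) + (\<Sum>i\<in>?I. (s' j i x * s' j i x) * LV)))
        \<le> (\<Sum>j\<in>?J. (s j x * s j x) * (2 * sqrt (real n) + LV))"
    proof (intro sum_mono mult_left_mono add_left_mono)
      show "(\<Sum>i\<in>?I. (s' j i x * s' j i x) * LV) \<le> LV" for j
        using mult_right_mono [OF s'_le [of j x] LV] by (simp only: sum_distrib_right mult_1)
    qed simp
    also have "\<dots> \<le> 2 * sqrt (real n) + LV"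
      using mult_right_mono [OF s_le [of x] nonneg]
      by (simp only: sum_distrib_right [symmetric] mult_1)
    finally show "2 * sqrt (real m / real k) * sqrt (real n) +
        (\<Sum>j\<in>?J. (s j x * s j x) * (2 * sqrt (real n) + (\<Sum>i\<in>?I. (s' j i x * s' j i x) * LV)))
        \<le> 2 * sqrt (real m / real k) * sqrt (real n) + 2 * sqrt (real n) + LV"
      by simp
  qed
  show ?thesis
  proof (rule computes_with_qker [OF n m _ _ E])
    show "psd A"
      unfolding A_def by (intro psd_sum psd_rank1)
    show "psd A'"
      unfolding A'_def by (intro psd_add psd_sum psd_rank1)
  next
    fix x assume x: "x \<in> canon_inputs n m" and hx: "h k n m x"
    obtain b a where "h_witness k n m x b a"
      using hx unfolding h_iff_witness by blast
    note w = h_witnessD [OF this]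
    have mc: "marked_cols n m x = {j \<in> ?J. marked n x j}"
      by (simp add: marked_cols_def)
    have "card (marked_cols n m x) = k"
      using bij_betw_same_card [OF w(1)] by simp
    \<comment> \<open>Here \<open>t x = k\<close>, so the outer search is calibrated and cannot
      fail.\<close>
    then have "f x = 0"
      by (simp add: f_def t_def mc fail_amp_def)
    \<comment> \<open>In an unmarked column the outer amplitude \<open>s j x\<close> vanishes; in a
      marked one the unique special cell makes the inner search exact.\<close>
    have f'0: "s j x * f' j x = 0" if j: "j \<in> ?J" for j
    proof (cases "marked n x j")
      case True
      then have "j \<in> b ` {1..k}"
        unfolding bij_betw_imp_surj_on [OF w(1)] using j by (simp add: mc)
      then obtain r where r: "r \<in> {1..k}" "j = b r" by blast
      have "{i \<in> ?I. x (i, j) \<noteq> blank} = {fst (a r)}"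
      proof -
        have "fst (a r) \<in> ?I" and eq: "(fst (a r), b r) = a r"
          using w(2,3) [OF r(1)] by (auto simp: grid_def prod_eq_iff)
        moreover have "x (i, j) \<noteq> blank \<longleftrightarrow> i = fst (a r)" if "i \<in> ?I" for i
        proof -
          have "x (i, j) \<noteq> blank \<longleftrightarrow> (i, b r) = a r"
            unfolding r(2) by (rule w(4) [OF r(1) that])
          also have "\<dots> \<longleftrightarrow> (i, b r) = (fst (a r), b r)"
            by (simp only: eq)
          also have "\<dots> \<longleftrightarrow> i = fst (a r)" by simp
          finally show ?thesis .
        qed
        ultimately show ?thesis by blast
      qed
      then have "f' j x = 0"
        by (simp only: f'_def t'_def fail_amp_def) simp
      then show ?thesis by simp
    qed (simp add: s_def)
    have sV0: "s j x * s' j i x * of_bool (\<not> V j i x) = 0" if j: "j \<in> ?J" and i: "i \<in> ?I" for i j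
    proof (cases "marked n x j \<and> x (i, j) \<noteq> blank")
      case True
      then have "V j i x"
        unfolding V_def using j by (intro h_imp_verifies [OF k(1) hx _ i]) (simp_all only: mc mem_Collect_eq simp_thms)
      then show ?thesis by simp
    next
      case False
      then show ?thesis unfolding s_def s'_def by (elim de_Morgan_conj [THEN iffD1, THEN disjE]) simp_all
    qed
    have "(\<Sum>j\<in>?J. (s j x * f' j x) * (s j x * f' j x)) = 0"
      by (intro sum.neutral ballI) (simp only: f'0 mult_zero_left)
    moreover have "(\<Sum>j\<in>?J. \<Sum>i\<in>?I. (s j x * s' j i x * of_bool (\<not> V j i x)) *
        (s j x * s' j i x * of_bool (\<not> V j i x))) = 0"
      by (intro sum.neutral ballI) (simp only: sV0 mult_zero_left)
    ultimately show "A' x x = 0"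
      unfolding A'_def \<open>f x = 0\<close> by (simp only: mult_zero_left add_0_left)
  next
    fix x assume x: "x \<in> canon_inputs n m" and hx: "\<not> h k n m x"
    have "\<not> V j i x" if "j \<in> ?J" "i \<in> ?I" for i j
    proof
      assume "V j i x"
      moreover have "x \<in> inputs n m" using x canon_inputs_subset by blast
      moreover have "(i, j) \<in> grid n m" using that by (simp add: grid_def)
      ultimately show False
        using verifies_imp_h [OF _ _ k(1)] hx unfolding V_def by blast
    qed
    then show "A x x = 0" by (simp add: A_def)
  next
    show "h k n m (canon n m x) = h k n m x" if "x \<in> inputs n m" for x
      using that k(1) by (rule h_canon)
    show "1 \<le> K" by (rule K)
    show "40 * (2 * sqrt (real m / real k) * sqrt (real n) + 2 * sqrt (real n) + LV) \<le> real K"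
      unfolding LV_def by (rule K)
  qed
qed

section \<open>Simplifying the bound\<close>

lemma floor_log_le_ln:
  assumes "1 \<le> m"
  shows "real (floor_log m) \<le> 2 * ln (real m)"
proof -
  have "(2::real) ^ floor_log m \<le> real m"
    using floor_log_exp2_le [of m] assms by (metis of_nat_le_iff of_nat_numeral of_nat_power less_le_trans zero_less_one)
  then have "ln ((2::real) ^ floor_log m) \<le> ln (real m)"
    using assms by (subst ln_le_cancel_iff) auto
  then have "real (floor_log m) * ln 2 \<le> ln (real m)"
    by (simp add: ln_realpow)
  \<comment> \<open>The bound \<open>exp 1 \<le> 3\<close> gives \<open>exp 1 \<le> 4\<close>, hence
    \<open>1 \<le> 2 * ln 2\<close>; this is the origin of the factor 2.\<close>
  moreover have "1 / 2 \<le> ln (2::real)"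
  proof -
    have "1 \<le> ln (2 ^ 2 :: real)"
      using exp_le by (subst ln_ge_iff) simp_all
    also have "\<dots> = 2 * ln 2"
      by (subst ln_realpow) simp_all
    finally show ?thesis by simp
  qed
  then have "real (floor_log m) * (1 / 2) \<le> real (floor_log m) * ln 2"
    by (intro mult_left_mono) simp_all
  ultimately show ?thesis by linarith
qed

theorem theorem18:
  shows "\<exists>C c::nat. \<forall>n m k::nat. 1 \<le> n \<longrightarrow> 1 \<le> k \<longrightarrow> k < m \<longrightarrow>
     real (Q n m (h k n m)) \<le>
       C * (ln (real n * real m + 2)) ^ c *
       (sqrt (real n * real m / real k) + sqrt (real k * real n) + real k + sqrt (real m))"
proof (rule exI [of _ 200], rule exI [of _ 1], intro allI impI)
  fix n m k :: nat
  assume n: "1 \<le> n" and k: "1 \<le> k" "k < m"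
  define X where "X = sqrt (real n * real m / real k) + sqrt (real k * real n) + real k + sqrt (real m)"
  define l where "l = ln (real n * real m + 2)"
  define L where "L = 2 * sqrt (real m / real k) * sqrt (real n) + 2 * sqrt (real n)
       + (real k + (sqrt (real n * real k) + sqrt m * (floor_log m + 2)))"
  \<comment> \<open>The ceiling secures \<open>40 * L \<le> K\<close>, the summand 1 secures
    \<open>1 \<le> K\<close>.\<close>
  define K where "K = nat \<lceil>40 * L\<rceil> + 1"
  have "computes_with n m (h k n m) K"
  proof (rule computes_with_h [OF n k])
    show "1 \<le> K" by (simp add: K_def)
    have "40 * L \<le> real K" unfolding K_def by linarith
    then show "40 * (2 * sqrt (real m / real k) * sqrt (real n) + 2 * sqrt (real n)
       + (real k + (sqrt (real n * real k) + sqrt m * (floor_log m + 2)))) \<le> real K"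
      unfolding L_def .
  qed
  then have "Q n m (h k n m) \<le> K"
    unfolding Q_def by (rule Least_le)
  moreover have "0 \<le> L" unfolding L_def by simp
  then have "real K \<le> 40 * L + 2" unfolding K_def by linarith
  ultimately have Q: "real (Q n m (h k n m)) \<le> 40 * L + 2" by linarith
  have m: "1 \<le> m" "2 \<le> m" using k by auto
  have nm: "real m \<le> real n * real m"
    using mult_right_mono [of 1 "real n" "real m"] n by simp
  \<comment> \<open>The \<open>+ 2\<close> inside the logarithm keeps its argument at least 3, above
    \<open>exp 1\<close>, so the factor \<open>l\<close> never shrinks a term.\<close>
  have l1: "1 \<le> l"
  proof -
    have "exp 1 \<le> (3::real)" by (rule exp_le)
    also have "\<dots> \<le> real n * real m + 2" using nm m(1) by linarith
    finally have "ln (exp 1) \<le> l"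
      unfolding l_def by (subst ln_le_cancel_iff) (auto intro: add_nonneg_pos)
    then show ?thesis by simp
  qed
  have "ln (real m) \<le> l"
  proof -
    have "0 < real m" using m(1) by simp
    moreover have "0 < real n * real m + 2" "real m \<le> real n * real m + 2"
      using nm \<open>0 < real m\<close> by linarith+
    ultimately show ?thesis
      unfolding l_def by (simp only: ln_le_cancel_iff)
  qed
  then have fl: "real (floor_log m + 2) \<le> 4 * l"
    using floor_log_le_ln [OF m(1)] l1 by simp
  have a: "2 * sqrt (real m / real k) * sqrt (real n) = 2 * sqrt (real n * real m / real k)"
    by (simp add: real_sqrt_mult real_sqrt_divide)
  \<comment> \<open>Absorbs the cost of the inner search into the conjunction over the cells of the
    cycle columns.\<close>
  have b: "sqrt (real n) \<le> sqrt (real k * real n)"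
    using mult_right_mono [of 1 "real k" "real n"] k by simp
  have c: "sqrt (real m) * real (floor_log m + 2) \<le> 4 * (l * sqrt (real m))"
    using mult_left_mono [OF fl, of "sqrt (real m)"] by (simp add: mult_ac)
  have X0: "0 \<le> sqrt (real n * real m / real k)" "0 \<le> sqrt (real k * real n)" "0 \<le> real k" "0 \<le> sqrt (real m)"
    by simp_all
  have lX: "y \<le> l * y" if "0 \<le> y" for y
    using mult_right_mono [OF l1 that] by simp
  have "L \<le> 2 * sqrt (real n * real m / real k) + 3 * sqrt (real k * real n) + real k + 4 * (l * sqrt (real m))"
    unfolding L_def a mult.commute [of "real n" "real k"] using b c by linarith
  also have "\<dots> \<le> 4 * (l * X)"
    using lX [OF X0(1)] lX [OF X0(2)] lX [OF X0(3)] X0 unfolding X_def distrib_left by linarith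
  finally have "40 * L + 2 \<le> 160 * (l * X) + 2" by linarith
  moreover have "1 \<le> l * X"
  proof -
    have "1 \<le> X" using k X0 unfolding X_def by linarith
    then show ?thesis using lX [of X] by linarith
  qed
  \<comment> \<open>The bound \<open>L \<le> 4 * (l * X)\<close> accounts for 160, and rounding adds
    at most \<open>2 * (l * X)\<close>; 200 leaves room.\<close>
  ultimately have "real (Q n m (h k n m)) \<le> 200 * (l * X)"
    using Q by linarith
  then show "real (Q n m (h k n m)) \<le> 200 * (ln (real n * real m + 2)) ^ 1 *
       (sqrt (real n * real m / real k) + sqrt (real k * real n) + real k + sqrt (real m))"
    unfolding X_def l_def by (simp add: mult.assoc)
qed

end
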